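(* Let $\mathcal{F}$ be a class of simple finite graphs closed under taking subgraphs, and suppose that every $G\in\mathcal{F}$ satisfies $ch'(G)=\chi'(G)$. Then Hadwiger's conjecture holds for every graph in $T(\mathcal{F})=\{T(G):G\in\mathcal{F}\}$, i.e. for every $G\in\mathcal{F}$ and every integer $t>0$, if $\chi(T(G))\geq t$ then $T(G)$ contains $K_t$ as a minor.
   Context: $\chi'(G)$ is the chromatic index (minimum number of colors in a proper edge coloring). $ch'(G)$, the edge choosability, is the least $k$ such that for every assignment of lists of $k$ colors to the edges of $G$ there is a proper edge coloring in which each edge receives a color from its list. The total graph $T(G)$ has vertex set $V(G)\cup E(G)$, two elements being adjacent in $T(G)$ if they are adjacent vertices, adjacent edges (sharing an endpoint), or an edge and one of its endpoints in $G$. A graph $H$ is a minor of $G$ if a graph isomorphic to $H$ can be obtained from $G$ by vertex deletions, edge deletions and edge contractions. *)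

theory Defs
  imports Main
begin

datatype 'a graph = Graph (verts: "'a set") (edges: "'a set set")

definition simple_graph :: "'a graph \<Rightarrow> bool" where
  "simple_graph G \<longleftrightarrow>
     finite (verts G) \<and> (\<forall>e\<in>edges G. e \<subseteq> verts G \<and> card e = 2)"

definition subgraph :: "'a graph \<Rightarrow> 'a graph \<Rightarrow> bool" where
  "subgraph H G \<longleftrightarrow> simple_graph H \<and> verts H \<subseteq> verts G \<and> edges H \<subseteq> edges G"

definition graph_iso :: "'a graph \<Rightarrow> 'b graph \<Rightarrow> bool" where
  "graph_iso G H \<longleftrightarrow>
     (\<exists>f. bij_betw f (verts G) (verts H) \<and>
          (\<forall>u\<in>verts G. \<forall>v\<in>verts G. {u, v} \<in> edges G \<longleftrightarrow> {f u, f v} \<in> edges H))"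

definition complete_graph :: "nat \<Rightarrow> nat graph" where
  "complete_graph t = Graph {..<t} {e. e \<subseteq> {..<t} \<and> card e = 2}"

definition proper_coloring :: "'a graph \<Rightarrow> ('a \<Rightarrow> nat) \<Rightarrow> bool" where
  "proper_coloring G c \<longleftrightarrow>
     (\<forall>u\<in>verts G. \<forall>v\<in>verts G. {u, v} \<in> edges G \<longrightarrow> c u \<noteq> c v)"

definition proper_edge_coloring :: "'a graph \<Rightarrow> ('a set \<Rightarrow> nat) \<Rightarrow> bool" where
  "proper_edge_coloring G c \<longleftrightarrow>
     (\<forall>e\<in>edges G. \<forall>f\<in>edges G. e \<noteq> f \<and> e \<inter> f \<noteq> {} \<longrightarrow> c e \<noteq> c f)"

definition chromatic_number :: "'a graph \<Rightarrow> nat" where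
  "chromatic_number G = (LEAST k. \<exists>c. proper_coloring G c \<and> c ` verts G \<subseteq> {..<k})"

definition chromatic_index :: "'a graph \<Rightarrow> nat" where
  "chromatic_index G = (LEAST k. \<exists>c. proper_edge_coloring G c \<and> c ` edges G \<subseteq> {..<k})"

(* Taking all colors from nat loses no generality: a finite graph only ever
   involves finitely many lists, each of them finite. *)
definition edge_choosable :: "'a graph \<Rightarrow> nat \<Rightarrow> bool" where
  "edge_choosable G k \<longleftrightarrow>
     (\<forall>L :: 'a set \<Rightarrow> nat set.
        (\<forall>e\<in>edges G. finite (L e) \<and> card (L e) = k) \<longrightarrow>
        (\<exists>c. proper_edge_coloring G c \<and> (\<forall>e\<in>edges G. c e \<in> L e)))"

definition edge_choosability :: "'a graph \<Rightarrow> nat" where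
  "edge_choosability G = (LEAST k. edge_choosable G k)"

definition total_graph :: "'a graph \<Rightarrow> ('a + 'a set) graph" where
  "total_graph G = Graph (verts G <+> edges G)
     ({{Inl u, Inl v} | u v. {u, v} \<in> edges G} \<union>
      {{Inr e, Inr f} | e f. e \<in> edges G \<and> f \<in> edges G \<and> e \<noteq> f \<and> e \<inter> f \<noteq> {}} \<union>
      {{Inl v, Inr e} | v e. e \<in> edges G \<and> v \<in> e})"

definition delete_vertex :: "'a \<Rightarrow> 'a graph \<Rightarrow> 'a graph" where
  "delete_vertex v G = Graph (verts G - {v}) {e \<in> edges G. v \<notin> e}"

definition delete_edge :: "'a set \<Rightarrow> 'a graph \<Rightarrow> 'a graph" where
  "delete_edge e G = Graph (verts G) (edges G - {e})"

(* The merged vertex keeps the name u. Removing {u} discards the loop that the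
   contracted edge becomes; parallel edges are identified since edges form a set. *)
definition contract_edge :: "'a \<Rightarrow> 'a \<Rightarrow> 'a graph \<Rightarrow> 'a graph" where
  "contract_edge u v G =
     (let r = (\<lambda>x. if x = v then u else x)
      in Graph (r ` verts G) ((\<lambda>e. r ` e) ` edges G - {{u}}))"

inductive minor_step :: "'a graph \<Rightarrow> 'a graph \<Rightarrow> bool" where
  del_vertex: "v \<in> verts G \<Longrightarrow> minor_step G (delete_vertex v G)"
| del_edge: "e \<in> edges G \<Longrightarrow> minor_step G (delete_edge e G)"
| contract: "{u, v} \<in> edges G \<Longrightarrow> u \<noteq> v \<Longrightarrow> minor_step G (contract_edge u v G)"

definition is_minor :: "'b graph \<Rightarrow> 'a graph \<Rightarrow> bool" where
  "is_minor H G \<longleftrightarrow> (\<exists>G'. minor_step\<^sup>*\<^sup>* G G' \<and> graph_iso H G')"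

lemma simple_graph_total_graph:
  assumes "simple_graph G"
  shows "simple_graph (total_graph G)"
proof -
  have fin: "finite (edges G)"
    by (rule finite_subset[of _ "Pow (verts G)"]) (use assms in \<open>auto simp: simple_graph_def\<close>)
  have ends: "u \<in> verts G \<and> v \<in> verts G \<and> u \<noteq> v" if "{u, v} \<in> edges G" for u v
  proof -
    have "{u, v} \<subseteq> verts G" "card {u, v} = 2"
      using assms that unfolding simple_graph_def by blast+
    then show ?thesis
      by (cases "u = v") simp_all
  qed
  have mem: "v \<in> verts G" if "e \<in> edges G" "v \<in> e" for v e
    using assms that unfolding simple_graph_def by blast
  have "e \<subseteq> verts (total_graph G) \<and> card e = 2" if e: "e \<in> edges (total_graph G)" for e
  proof -
    from e consider
        u v where "e = {Inl u, Inl v}" "{u, v} \<in> edges G"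
      | a b where "e = {Inr a, Inr b}" "a \<in> edges G" "b \<in> edges G" "a \<noteq> b"
      | v a where "e = {Inl v, Inr a}" "a \<in> edges G" "v \<in> a"
      unfolding total_graph_def graph.sel by blast
    then show ?thesis
      by cases (simp_all add: total_graph_def InlI InrI ends mem)
  qed
  moreover have "finite (verts (total_graph G))"
    using assms fin by (simp add: simple_graph_def total_graph_def)
  ultimately show ?thesis
    by (simp add: simple_graph_def)
qed

lemma simple_graph_contract_edge:
  assumes "simple_graph G"
  shows "simple_graph (contract_edge u v G)"
proof -
  define r where "r = (\<lambda>x. if x = v then u else x)"
  have "r ` e \<subseteq> r ` verts G \<and> card (r ` e) = 2"
    if e: "e \<in> edges G" and ne: "r ` e \<noteq> {u}" for e
  proof -
    have sub: "e \<subseteq> verts G" and "card e = 2"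
      using assms e unfolding simple_graph_def by blast+
    then obtain x y where xy: "e = {x, y}" "x \<noteq> y"
      by (meson card_2_iff)
    have "r x \<noteq> r y"
    proof
      assume "r x = r y"
      then have "r x = u" "r y = u"
        using xy(2) by (simp_all add: r_def split: if_splits)
      then show False
        using ne xy(1) by simp
    qed
    then show ?thesis
      using sub xy(1) by simp
  qed
  then have "\<forall>e\<in>(\<lambda>e. r ` e) ` edges G - {{u}}. e \<subseteq> r ` verts G \<and> card e = 2"
    by blast
  then show ?thesis
    using assms by (simp add: simple_graph_def contract_edge_def r_def)
qed

lemma simple_graph_minor_step:
  assumes "minor_step G G'" and "simple_graph G"
  shows "simple_graph G'"
  using assms
proof cases
  case (del_vertex v)
  then show ?thesis
    using assms(2) by (simp add: simple_graph_def delete_vertex_def subset_Diff_insert)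
next
  case (del_edge e)
  then show ?thesis
    using assms(2) by (simp add: simple_graph_def delete_edge_def)
next
  case (contract u v)
  then show ?thesis
    using assms(2) by (simp add: simple_graph_contract_edge)
qed

end

theory Submission
  imports Defs
begin

text \<open>Pass to a subgraph \<open>G\<close> minimal with the property that \<open>T(G)\<close> is not \<open>k\<close>-colourable, where
  \<open>k = t - 1\<close>, and let \<open>D\<close> be its maximum degree. Colouring the vertices greedily and then the
  edges from the lists of colours not used on their ends gives \<open>\<chi>(T(G)) \<le> max (D + 1) (ch'(G) + 2)\<close>,
  hence \<open>k \<le> D + 2\<close> by \<open>ch' = \<chi>'\<close> and Vizing's theorem. A vertex \<open>v\<close> of degree \<open>D\<close> and its edges
  \<open>e\<close> form a clique of size \<open>D + 1\<close> in \<open>T(G)\<close>. If \<open>k \<ge> D + 1\<close>, minimality makes every \<open>G - x\<close>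
  connected, so \<open>V(G - v)\<close> is one more branch set. If \<open>k = D + 2\<close>, minimality also
  forces minimum degree \<open>3\<close>, an explicit colouring excluding the case \<open>D = 2\<close>. Some neighbour
  \<open>u\<close> of \<open>v\<close> leaves \<open>W = V(G) - {v, u}\<close> connected, and for two further edges \<open>uw\<close>, \<open>uw'\<close> the
  sets \<open>W + uw\<close> and \<open>E(G[W]) + uw' + u\<close> are two more branch sets.\<close>

section \<open>Connected sets and minor models\<close>

text \<open>Because the class is closed under subgraphs, the equality of the two edge indices also
  holds in the critical subgraph, and a minor of its total graph is a minor of the original one;
  passing to it costs nothing. The target is \<open>k + 1\<close> branch sets. An edge loses two
  colours to its ends and Vizing's bound is one above \<open>D\<close>, so \<open>k\<close> exceeds
  \<open>D\<close> by at most 2 and the star at a vertex of maximum degree is at most two branch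
  sets short. A missing set must touch every edge at \<open>v\<close>, hence has to run through the
  rest of the graph; this is why connectivity after deleting vertices is needed. When two sets are
  missing, one connected set \<open>W\<close> is used twice, by its vertices and by its edges, which
  are disjoint parts of \<open>T(G)\<close>; \<open>u\<close> and two of its edges provide the
  contact with the edge \<open>vu\<close>. The edge copy of \<open>W\<close> reaches an edge
  \<open>vs\<close> only through an edge at \<open>s\<close> that avoids \<open>v\<close> and
  \<open>u\<close>, and this is the source of minimum degree 3.\<close>

definition conn :: "'a graph \<Rightarrow> 'a set \<Rightarrow> bool" where
  "conn G S \<longleftrightarrow> S \<noteq> {} \<and>
     (\<forall>A. A \<subseteq> S \<longrightarrow> A \<noteq> {} \<longrightarrow> A \<noteq> S \<longrightarrow> (\<exists>a\<in>A. \<exists>b\<in>S - A. {a, b} \<in> edges G))"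

lemma connI:
  assumes "S \<noteq> {}"
    and "\<And>A. A \<subseteq> S \<Longrightarrow> A \<noteq> {} \<Longrightarrow> A \<noteq> S \<Longrightarrow> \<exists>a\<in>A. \<exists>b\<in>S - A. {a, b} \<in> edges G"
  shows "conn G S"
  using assms unfolding conn_def by blast

text \<open>Connectivity is stated by cuts, not paths: each argument below needs just one edge
  leaving a proper part, and walks never have to be handled.\<close>

lemma connE:
  assumes "conn G S" "A \<subseteq> S" "A \<noteq> {}" "A \<noteq> S"
  obtains a b where "a \<in> A" "b \<in> S" "b \<notin> A" "{a, b} \<in> edges G"
  using assms unfolding conn_def by blast

lemma conn_nonempty: "conn G S \<Longrightarrow> S \<noteq> {}"
  by (simp add: conn_def)

lemma conn_singleton: "conn G {x}"
  unfolding conn_def by blast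

lemma conn_mono:
  assumes "conn G S" "\<And>a b. a \<in> S \<Longrightarrow> b \<in> S \<Longrightarrow> {a, b} \<in> edges G \<Longrightarrow> {a, b} \<in> edges H"
  shows "conn H S"
proof (rule connI)
  show "S \<noteq> {}" using assms(1) by (rule conn_nonempty)
next
  fix A assume A: "A \<subseteq> S" "A \<noteq> {}" "A \<noteq> S"
  then obtain a b where "a \<in> A" "b \<in> S" "b \<notin> A" "{a, b} \<in> edges G"
    using assms(1) by (elim connE)
  with A(1) show "\<exists>a\<in>A. \<exists>b\<in>S - A. {a, b} \<in> edges H"
    using assms(2)[of a b] by blast
qed

lemma conn_insert:
  assumes S: "conn G S" and s: "s \<in> S" "{x, s} \<in> edges G"
  shows "conn G (insert x S)"
proof (rule connI)
  fix A assume A: "A \<subseteq> insert x S" "A \<noteq> {}" "A \<noteq> insert x S"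
  have sx: "{s, x} \<in> edges G" using s(2) by (simp add: insert_commute)
  show "\<exists>a\<in>A. \<exists>b\<in>insert x S - A. {a, b} \<in> edges G"
  proof (cases "A \<inter> S = {} \<or> S \<subseteq> A")
    case True
    then show ?thesis
    proof
      assume "A \<inter> S = {}"
      then have "A = {x}" using A by blast
      then show ?thesis using s \<open>A \<inter> S = {}\<close> by blast
    next
      assume "S \<subseteq> A"
      then have "x \<notin> A" using A by blast
      then show ?thesis using \<open>S \<subseteq> A\<close> s(1) sx by blast
    qed
  next
    case False
    then have "A \<inter> S \<subseteq> S" "A \<inter> S \<noteq> {}" "A \<inter> S \<noteq> S" by blast+
    then obtain a b where "a \<in> A \<inter> S" "b \<in> S" "b \<notin> A \<inter> S" "{a, b} \<in> edges G"
      by (rule connE[OF S])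
    then show ?thesis by blast
  qed
qed simp

lemma conn_image:
  assumes S: "conn G S" and h: "\<And>a b. {a, b} \<in> edges G \<Longrightarrow> {h a, h b} \<in> edges H"
  shows "conn H (h ` S)"
proof (rule connI)
  show "h ` S \<noteq> {}" using conn_nonempty[OF S] by simp
next
  fix A assume A: "A \<subseteq> h ` S" "A \<noteq> {}" "A \<noteq> h ` S"
  define A' where "A' = {s \<in> S. h s \<in> A}"
  have "A' \<subseteq> S" "A' \<noteq> {}" "A' \<noteq> S" using A unfolding A'_def by blast+
  then obtain a b where "a \<in> A'" "b \<in> S" "b \<notin> A'" "{a, b} \<in> edges G"
    by (rule connE[OF S])
  then show "\<exists>a\<in>A. \<exists>b\<in>h ` S - A. {a, b} \<in> edges H"
    using h[of a b] unfolding A'_def by blast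
qed

text \<open>The branch sets of a complete minor. They form a set rather than an indexed family, so
  the order of the complete graph is \<open>card\<close>. Vertices outside all of them are
  allowed.\<close>

definition minor_model :: "'a graph \<Rightarrow> 'a set set \<Rightarrow> bool" where
  "minor_model G \<B> \<longleftrightarrow>
     (\<forall>B\<in>\<B>. B \<subseteq> verts G \<and> conn G B) \<and>
     (\<forall>B\<in>\<B>. \<forall>C\<in>\<B>. B \<noteq> C \<longrightarrow> B \<inter> C = {} \<and> (\<exists>b\<in>B. \<exists>c\<in>C. {b, c} \<in> edges G))"

lemma minor_modelD:
  assumes "minor_model G \<B>" "B \<in> \<B>"
  shows "B \<subseteq> verts G" "conn G B"
    and "C \<in> \<B> \<Longrightarrow> B \<noteq> C \<Longrightarrow> B \<inter> C = {}"
    and "C \<in> \<B> \<Longrightarrow> B \<noteq> C \<Longrightarrow> \<exists>b\<in>B. \<exists>c\<in>C. {b, c} \<in> edges G"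
  using assms by (simp_all add: minor_model_def)

lemma minor_model_mono:
  assumes "minor_model H \<B>" "verts H \<subseteq> verts G" "edges H \<subseteq> edges G"
  shows "minor_model G \<B>"
  unfolding minor_model_def
proof (intro conjI ballI impI)
  fix B assume "B \<in> \<B>"
  then have "B \<subseteq> verts H" "conn H B" using assms(1) by (simp_all add: minor_model_def)
  then show "B \<subseteq> verts G" "conn G B"
    using assms(2,3) conn_mono[of H B G] by blast+
next
  fix B C assume "B \<in> \<B>" "C \<in> \<B>" "B \<noteq> C"
  then show "B \<inter> C = {}" "\<exists>b\<in>B. \<exists>c\<in>C. {b, c} \<in> edges G"
    using minor_modelD(3,4)[OF assms(1), of B C] assms(3) by blast+
qed

lemma minor_model_subset: "minor_model G \<B> \<Longrightarrow> \<C> \<subseteq> \<B> \<Longrightarrow> minor_model G \<C>"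
  unfolding minor_model_def by (meson subsetD)

lemma is_minor_step: "minor_step G G' \<Longrightarrow> is_minor H G' \<Longrightarrow> is_minor H G"
  unfolding is_minor_def by (meson converse_rtranclp_into_rtranclp)

lemma simple_graph_edge:
  assumes "simple_graph G" "{u, v} \<in> edges G"
  shows "u \<in> verts G" "v \<in> verts G" "u \<noteq> v"
proof -
  have "{u, v} \<subseteq> verts G" "card {u, v} = 2"
    using assms unfolding simple_graph_def by blast+
  then show "u \<in> verts G" "v \<in> verts G" "u \<noteq> v" by auto
qed

lemma simple_graph_edgeE:
  assumes "simple_graph G" "e \<in> edges G"
  obtains u v where "e = {u, v}" "u \<noteq> v" "u \<in> verts G" "v \<in> verts G"
proof -
  have "e \<subseteq> verts G" "card e = 2" using assms unfolding simple_graph_def by blast+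
  then show ?thesis using that by (auto simp: card_2_iff)
qed

lemma simple_graph_finite_edges:
  assumes "simple_graph G"
  shows "finite (edges G)"
  by (rule finite_subset[of _ "Pow (verts G)"]) (use assms in \<open>auto simp: simple_graph_def\<close>)

lemma minor_model_delete_vertex:
  assumes "minor_model G \<B>" "v \<notin> \<Union>\<B>"
  shows "minor_model (delete_vertex v G) \<B>"
  unfolding minor_model_def
proof (intro conjI ballI impI)
  fix B assume B: "B \<in> \<B>"
  then have "B \<subseteq> verts G" "conn G B" "v \<notin> B" using assms by (auto simp: minor_model_def)
  then show "B \<subseteq> verts (delete_vertex v G)" "conn (delete_vertex v G) B"
    using conn_mono[of G B "delete_vertex v G"] by (auto simp: delete_vertex_def)
next
  fix B C assume *: "B \<in> \<B>" "C \<in> \<B>" "B \<noteq> C"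
  then show "B \<inter> C = {}" using assms(1) by (simp add: minor_model_def)
  obtain b c where bc: "b \<in> B" "c \<in> C" "{b, c} \<in> edges G"
    using minor_modelD(4)[OF assms(1), of B C] * by blast
  then have "v \<notin> {b, c}" using assms(2) * by blast
  then show "\<exists>b\<in>B. \<exists>c\<in>C. {b, c} \<in> edges (delete_vertex v G)"
    using bc by (auto simp: delete_vertex_def)
qed

lemma contract_edge_edgeI:
  assumes "{a, b} \<in> edges G" and r: "r = (\<lambda>x. if x = v then u else x)" and "r a \<noteq> r b"
  shows "{r a, r b} \<in> edges (contract_edge u v G)"
proof -
  have "{r a, r b} = r ` {a, b}" by simp
  then have "{r a, r b} \<in> (`) r ` edges G" using assms(1) by (rule image_eqI)
  moreover have "{r a, r b} \<noteq> {u}" using assms(3) by (auto simp: doubleton_eq_iff)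
  ultimately show ?thesis unfolding contract_edge_def Let_def r[symmetric] by simp
qed

text \<open>A cut of the contracted set lifts to a cut of \<open>C\<close> that puts
  \<open>v\<close> on the side of \<open>u\<close>. The edge crossing the lifted cut is therefore
  not the contracted one, and its image crosses the original cut.\<close>

lemma conn_contract_edge:
  assumes C: "conn G C" and uv: "v \<in> C \<Longrightarrow> u \<in> C" "u \<noteq> v"
  shows "conn (contract_edge u v G) (C - {v})"
proof (rule connI)
  show "C - {v} \<noteq> {}" using conn_nonempty[OF C] uv by blast
next
  fix A assume A: "A \<subseteq> C - {v}" "A \<noteq> {}" "A \<noteq> C - {v}"
  define r where "r = (\<lambda>x. if x = v then u else x)"
  define A' where "A' = (if u \<in> A then A \<union> ({v} \<inter> C) else A)"
  have "A' \<subseteq> C" "A' \<noteq> {}" "A' \<noteq> C" using A uv unfolding A'_def by auto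
  then obtain a b where ab: "a \<in> A'" "b \<in> C" "b \<notin> A'" "{a, b} \<in> edges G"
    by (rule connE[OF C])
  have ra: "r a \<in> A" using ab(1) A(1) by (auto simp: A'_def r_def split: if_splits)
  have rb: "r b \<in> C - {v} - A"
    using ab(2,3) uv by (auto simp: A'_def r_def split: if_splits)
  show "\<exists>a\<in>A. \<exists>b\<in>C - {v} - A. {a, b} \<in> edges (contract_edge u v G)"
  proof (intro bexI)
    show "{r a, r b} \<in> edges (contract_edge u v G)"
      using ra rb by (intro contract_edge_edgeI[OF ab(4) r_def]) auto
  qed (fact rb, fact ra)
qed

text \<open>Only \<open>B\<close> contains \<open>v\<close>, so removing that name leaves the other
  branch sets as they are. Since \<open>u\<close> stays in \<open>B\<close>, no set becomes empty,
  and disjoint nonempty sets remain distinct.\<close>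

lemma minor_model_contract_edge:
  assumes m: "minor_model G \<B>" and B: "B \<in> \<B>" and uv: "u \<in> B" "v \<in> B" "u \<noteq> v"
  shows "minor_model (contract_edge u v G) ((\<lambda>C. C - {v}) ` \<B>)"
    and "card ((\<lambda>C. C - {v}) ` \<B>) = card \<B>"
proof -
  define r where "r = (\<lambda>x. if x = v then u else x)"
  have disj: "C \<inter> D = {}" if "C \<in> \<B>" "D \<in> \<B>" "C \<noteq> D" for C D
    using minor_modelD(3)[OF m] that by blast
  have vC: "u \<in> C" if "C \<in> \<B>" "v \<in> C" for C using disj[OF B that(1)] that uv by blast
  have rC: "r c \<in> C - {v}" if "C \<in> \<B>" "c \<in> C" for c C
    using that vC uv by (auto simp: r_def)
  have ne: "C - {v} \<noteq> {}" if "C \<in> \<B>" for C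
    using vC[OF that] uv(3) conn_nonempty[OF minor_modelD(2)[OF m that]] by blast
  have "inj_on (\<lambda>C. C - {v}) \<B>"
  proof (rule inj_onI)
    fix C D assume "C \<in> \<B>" "D \<in> \<B>" "C - {v} = D - {v}"
    then show "C = D" using disj[of C D] ne[of C] by blast
  qed
  then show "card ((\<lambda>C. C - {v}) ` \<B>) = card \<B>" by (rule card_image)
  show "minor_model (contract_edge u v G) ((\<lambda>C. C - {v}) ` \<B>)"
    unfolding minor_model_def
  proof (intro conjI ballI impI)
    fix C' assume "C' \<in> (\<lambda>C. C - {v}) ` \<B>"
    then obtain C where C: "C \<in> \<B>" "C' = C - {v}" by blast
    have "C \<subseteq> verts G" "conn G C" using minor_modelD[OF m C(1)] by blast+
    then show "C' \<subseteq> verts (contract_edge u v G)"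
      by (auto simp: C(2) contract_edge_def Let_def image_iff)
    show "conn (contract_edge u v G) C'"
      unfolding C(2) using \<open>conn G C\<close> vC C(1) uv(3) by (intro conn_contract_edge) auto
  next
    fix C' D' assume "C' \<in> (\<lambda>C. C - {v}) ` \<B>" "D' \<in> (\<lambda>C. C - {v}) ` \<B>" "C' \<noteq> D'"
    then obtain C D where CD: "C \<in> \<B>" "C' = C - {v}" "D \<in> \<B>" "D' = D - {v}" "C \<noteq> D" by blast
    then show "C' \<inter> D' = {}" using disj by blast
    obtain c d where cd: "c \<in> C" "d \<in> D" "{c, d} \<in> edges G"
      using minor_modelD(4)[OF m CD(1,3,5)] by blast
    have "r c \<in> C'" "r d \<in> D'" using rC CD cd by blast+
    then show "\<exists>b\<in>C'. \<exists>c\<in>D'. {b, c} \<in> edges (contract_edge u v G)"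
    proof (intro bexI)
      show "{r c, r d} \<in> edges (contract_edge u v G)"
        using \<open>r c \<in> C'\<close> \<open>r d \<in> D'\<close> \<open>C' \<inter> D' = {}\<close>
        by (intro contract_edge_edgeI[OF cd(3) r_def]) auto
    qed (use \<open>r c \<in> C'\<close> \<open>r d \<in> D'\<close> in simp_all)
  qed
qed

lemma complete_graph_minor_singletons:
  assumes G: "simple_graph G" and m: "minor_model G \<B>"
    and cover: "\<Union>\<B> = verts G" and sing: "\<And>B. B \<in> \<B> \<Longrightarrow> \<exists>x. B = {x}"
  shows "is_minor (complete_graph (card \<B>)) G"
proof -
  have B: "\<B> = (\<lambda>x. {x}) ` verts G"
  proof (intro equalityI subsetI)
    fix B assume "B \<in> \<B>"
    then show "B \<in> (\<lambda>x. {x}) ` verts G" using cover sing[of B] by blast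
  next
    fix B assume "B \<in> (\<lambda>x. {x}) ` verts G"
    then obtain x C where "B = {x}" "x \<in> C" "C \<in> \<B>" using cover by blast
    then show "B \<in> \<B>" using sing[of C] by auto
  qed
  have "inj_on (\<lambda>x. {x}) (verts G)" by simp
  then have t: "card \<B> = card (verts G)" unfolding B by (rule card_image)
  have adj: "{x, y} \<in> edges G" if "x \<in> verts G" "y \<in> verts G" "x \<noteq> y" for x y
  proof -
    have "{x} \<in> \<B>" "{y} \<in> \<B>" "{x} \<noteq> {y}" using that B by auto
    then have "\<exists>b\<in>{x}. \<exists>c\<in>{y}. {b, c} \<in> edges G"
      by (rule minor_modelD(4)[OF m])
    then show ?thesis by simp
  qed
  have "finite (verts G)" using G by (simp add: simple_graph_def)
  then obtain h where h: "bij_betw h {..<card \<B>} (verts G)"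
    unfolding t using ex_bij_betw_nat_finite[of "verts G"] by (auto simp: atLeast0LessThan)
  have "{i, j} \<in> edges (complete_graph (card \<B>)) \<longleftrightarrow> {h i, h j} \<in> edges G"
    if ij: "i < card \<B>" "j < card \<B>" for i j
  proof (cases "i = j")
    case True
    then show ?thesis using simple_graph_edge(3)[OF G, of "h i" "h j"]
      by (auto simp: complete_graph_def)
  next
    case False
    have "h i \<in> verts G" "h j \<in> verts G" "h i \<noteq> h j"
      using h ij False unfolding bij_betw_def inj_on_def by auto
    then show ?thesis using ij False adj by (simp add: complete_graph_def)
  qed
  then have "graph_iso (complete_graph (card \<B>)) G"
    unfolding graph_iso_def using h by (auto simp: complete_graph_def)
  then show ?thesis unfolding is_minor_def by blast
qed

text \<open>A vertex outside all branch sets can be deleted, and a branch set with two vertices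
  contains an edge to contract; both lower the number of vertices and keep the number of branch
  sets. When neither is possible, the branch sets are the singletons of all vertices and the graph
  is complete.\<close>

lemma minor_model_is_minor:
  assumes "simple_graph G" "minor_model G \<B>"
  shows "is_minor (complete_graph (card \<B>)) G"
  using assms
proof (induction "card (verts G)" arbitrary: G \<B> rule: less_induct)
  case less
  note G = less.prems(1) and m = less.prems(2)
  have fin: "finite (verts G)" using G by (simp add: simple_graph_def)
  have "\<Union>\<B> \<subseteq> verts G" using minor_modelD(1)[OF m] by blast
  then consider v where "v \<in> verts G" "v \<notin> \<Union>\<B>"
    | B where "B \<in> \<B>" "\<nexists>x. B = {x}"
    | "\<Union>\<B> = verts G" "\<And>B. B \<in> \<B> \<Longrightarrow> \<exists>x. B = {x}" by blast
  then show ?case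
  proof cases
    case 1
    have step: "minor_step G (delete_vertex v G)" using 1(1) by (rule minor_step.del_vertex)
    have "card (verts (delete_vertex v G)) < card (verts G)"
      using card_Diff1_less[OF fin 1(1)] by (simp add: delete_vertex_def)
    then have "is_minor (complete_graph (card \<B>)) (delete_vertex v G)"
      using less.hyps simple_graph_minor_step[OF step G] minor_model_delete_vertex[OF m 1(2)]
      by blast
    then show ?thesis using is_minor_step[OF step] by blast
  next
    case 2
    then have B: "conn G B" "B \<subseteq> verts G" using minor_modelD[OF m] by blast+
    obtain x where "x \<in> B" using conn_nonempty[OF B(1)] by blast
    then have "{x} \<subseteq> B" "{x} \<noteq> {}" "{x} \<noteq> B" using 2(2) by auto
    then obtain u v where uv: "u \<in> B" "v \<in> B" "{u, v} \<in> edges G"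
      using connE[OF B(1)] \<open>x \<in> B\<close> by (metis singletonD)
    have ne: "u \<noteq> v" using simple_graph_edge[OF G uv(3)] by blast
    have step: "minor_step G (contract_edge u v G)" using uv(3) ne by (rule minor_step.contract)
    have "verts (contract_edge u v G) = verts G - {v}"
      using ne uv B(2) by (auto simp: contract_edge_def Let_def)
    then have "card (verts (contract_edge u v G)) < card (verts G)"
      using uv(2) B(2) fin by (auto intro!: card_Diff1_less)
    then have "is_minor (complete_graph (card \<B>)) (contract_edge u v G)"
      using less.hyps simple_graph_minor_step[OF step G]
        minor_model_contract_edge(1)[OF m 2(1) uv(1,2) ne]
      unfolding minor_model_contract_edge(2)[OF m 2(1) uv(1,2) ne, symmetric] by blast
    then show ?thesis using is_minor_step[OF step] by blast
  next
    case 3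
    then show ?thesis using complete_graph_minor_singletons[OF G m] by blast
  qed
qed

section \<open>Adjacency in total graphs and non-separating neighbours\<close>

lemma total_graph_edgeI:
  shows "{u, v} \<in> edges G \<Longrightarrow> {Inl u, Inl v} \<in> edges (total_graph G)"
    and "e \<in> edges G \<Longrightarrow> f \<in> edges G \<Longrightarrow> e \<noteq> f \<Longrightarrow> e \<inter> f \<noteq> {} \<Longrightarrow>
         {Inr e, Inr f} \<in> edges (total_graph G)"
    and "e \<in> edges G \<Longrightarrow> v \<in> e \<Longrightarrow> {Inl v, Inr e} \<in> edges (total_graph G)"
    and "e \<in> edges G \<Longrightarrow> v \<in> e \<Longrightarrow> {Inr e, Inl v} \<in> edges (total_graph G)"
  unfolding total_graph_def graph.sel by blast+

lemma total_graph_edgeE: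
  assumes "x \<in> edges (total_graph G)"
  obtains u v where "x = {Inl u, Inl v}" "{u, v} \<in> edges G"
    | d e where "x = {Inr d, Inr e}" "d \<in> edges G" "e \<in> edges G" "d \<noteq> e" "d \<inter> e \<noteq> {}"
    | v e where "x = {Inl v, Inr e}" "e \<in> edges G" "v \<in> e"
  using assms unfolding total_graph_def graph.sel by blast

text \<open>A proper part \<open>X\<close> of the edges inside \<open>S\<close> either covers
  \<open>S\<close>, and then any edge outside \<open>X\<close> meets it, or it misses a vertex of
  \<open>S\<close>, and then an edge of \<open>G\<close> leaves the covered vertices. The edge
  \<open>e0\<close> excludes a one-vertex \<open>S\<close>, which would give an empty set.\<close>

lemma conn_line_graph:
  assumes G: "simple_graph G" and S: "conn G S" "e0 \<in> edges G" "e0 \<subseteq> S"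
  shows "conn (total_graph G) (Inr ` {e \<in> edges G. e \<subseteq> S})"
proof (rule connI)
  show "Inr ` {e \<in> edges G. e \<subseteq> S} \<noteq> {}" using S by auto
next
  fix A :: "('a + 'a set) set"
  assume A: "A \<subseteq> Inr ` {e \<in> edges G. e \<subseteq> S}" "A \<noteq> {}" "A \<noteq> Inr ` {e \<in> edges G. e \<subseteq> S}"
  let ?E = "{e \<in> edges G. e \<subseteq> S}"
  define X where "X = {e \<in> ?E. Inr e \<in> A}"
  have AX: "A = Inr ` X" using A(1) unfolding X_def by blast
  have X: "X \<subseteq> ?E" "X \<noteq> {}" "X \<noteq> ?E" using A AX unfolding X_def by auto
  have ne: "\<exists>a b. e = {a, b}" if "e \<in> edges G" for e using simple_graph_edgeE[OF G that] by blast
  have "\<exists>e\<in>X. \<exists>f\<in>?E - X. e \<inter> f \<noteq> {}"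
  proof (cases "\<Union>X = S")
    case True
    obtain f where f: "f \<in> ?E - X" using X by blast
    then obtain a b where ab: "f = {a, b}" using ne by blast
    then have "a \<in> \<Union>X" using f True by blast
    then obtain e where "e \<in> X" "a \<in> e" by blast
    then have "e \<inter> f \<noteq> {}" using ab by blast
    then show ?thesis using \<open>e \<in> X\<close> f by blast
  next
    case False
    obtain e where "e \<in> X" using X(2) by blast
    moreover from this obtain a b where "e = {a, b}" using X(1) ne by blast
    ultimately have "a \<in> \<Union>X" by blast
    then have "\<Union>X \<subseteq> S" "\<Union>X \<noteq> {}" using X(1) by blast+
    then obtain a b where ab: "a \<in> \<Union>X" "b \<in> S" "b \<notin> \<Union>X" "{a, b} \<in> edges G"
      using connE[OF S(1) _ _ False] by blast
    then have "{a, b} \<in> ?E - X" using X(1) by blast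
    moreover obtain e where "e \<in> X" "a \<in> e" using ab(1) by blast
    moreover have "e \<inter> {a, b} \<noteq> {}" using \<open>a \<in> e\<close> by blast
    ultimately show ?thesis by (intro bexI)
  qed
  then obtain e f where ef: "e \<in> X" "f \<in> ?E - X" "e \<inter> f \<noteq> {}" by blast
  then have "{Inr e, Inr f} \<in> edges (total_graph G)"
    using X(1) by (intro total_graph_edgeI) auto
  then show "\<exists>a\<in>A. \<exists>b\<in>Inr ` ?E - A. {a, b} \<in> edges (total_graph G)"
    using ef unfolding AX by auto
qed

text \<open>A neighbour \<open>u\<close> of \<open>v\<close> together with a part \<open>C\<close> that it separates from the rest
  of \<open>G - v\<close> is chosen with \<open>C\<close> smallest. By 2-connectivity \<open>v\<close> has a neighbour in \<open>C\<close>,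
  and that neighbour separates off a smaller part.\<close>

lemma ex_neighbour_non_cut:
  assumes fin: "finite V" and v: "v \<in> V"
    and two: "\<And>x. x \<in> V \<Longrightarrow> conn G (V - {x})"
    and nb: "x0 \<in> V" "x0 \<noteq> v" "{v, x0} \<in> edges G"
    and card3: "\<And>x. V \<noteq> {v, x}"
  shows "\<exists>u. u \<in> V \<and> u \<noteq> v \<and> {v, u} \<in> edges G \<and> conn G (V - {v, u})"
proof (rule ccontr)
  assume neg: "\<not> ?thesis"
  define bad where "bad u C \<longleftrightarrow> u \<in> V \<and> u \<noteq> v \<and> {v, u} \<in> edges G \<and>
     C \<subseteq> V - {v, u} \<and> C \<noteq> {} \<and> C \<noteq> V - {v, u} \<and>
     (\<forall>a\<in>C. \<forall>b\<in>V - {v, u} - C. {a, b} \<notin> edges G)" for u C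
  have ex: "\<exists>C. bad u C" if "u \<in> V" "u \<noteq> v" "{v, u} \<in> edges G" for u
  proof -
    have "\<not> conn G (V - {v, u})" "V - {v, u} \<noteq> {}"
      using neg that v card3[of u] by blast+
    then show ?thesis using that unfolding conn_def bad_def by blast
  qed
  obtain C0 where "bad x0 C0" using ex nb by blast
  then obtain n where "\<exists>u C. bad u C \<and> card C = n" by blast
  then have "\<exists>u C. bad u C \<and> card C = (LEAST n. \<exists>u C. bad u C \<and> card C = n)"
    by (rule LeastI)
  then obtain u C where uC: "bad u C" and "card C = (LEAST n. \<exists>u C. bad u C \<and> card C = n)" by blast
  then have least: "card C \<le> card C'" if "bad u' C'" for u' C'
    using that by (metis (mono_tags, lifting) Least_le)
  have uV: "u \<in> V" "u \<noteq> v" and C: "C \<subseteq> V - {v, u}" "C \<noteq> {}" "C \<noteq> V - {v, u}"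
    and closed: "\<And>a b. a \<in> C \<Longrightarrow> b \<in> V - {v, u} \<Longrightarrow> {a, b} \<in> edges G \<Longrightarrow> b \<in> C"
    using uC unfolding bad_def by blast+
  obtain u' where u': "u' \<in> C" "{v, u'} \<in> edges G"
  proof -
    have "C \<subseteq> V - {u}" "C \<noteq> V - {u}" using C v uV by auto
    then obtain a b where ab: "a \<in> C" "b \<in> V - {u}" "b \<notin> C" "{a, b} \<in> edges G"
      using connE[OF two[OF uV(1)] _ C(2)] by blast
    then have "b = v" using closed by blast
    then show ?thesis using that ab(1,4) by (simp add: insert_commute)
  qed
  have u'V: "u' \<in> V" "u' \<noteq> v" "u' \<noteq> u" using u'(1) C(1) by blast+
  obtain C1 where C1: "bad u' C1" using ex u'V u'(2) by blast
  \<comment> \<open>Either side of the cut at \<open>u'\<close> may serve as the separated part; the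
    one without \<open>u\<close> is taken.\<close>
  define C' where "C' = (if u \<in> C1 then V - {v, u'} - C1 else C1)"
  have C': "bad u' C'" "u \<notin> C'"
  proof -
    have sym: "\<forall>a\<in>V - {v, u'} - C1. \<forall>b\<in>C1. {a, b} \<notin> edges G"
      using C1 unfolding bad_def by (metis Diff_iff insert_commute)
    have "V - {v, u'} - (V - {v, u'} - C1) = C1" using C1 unfolding bad_def by blast
    then have "bad u' (V - {v, u'} - C1)" using sym C1 unfolding bad_def by auto
    then show "bad u' C'" using C1 unfolding C'_def by simp
    show "u \<notin> C'" unfolding C'_def by simp
  qed
  have closed': "\<And>a b. a \<in> C' \<Longrightarrow> b \<in> V - {v, u'} \<Longrightarrow> {a, b} \<in> edges G \<Longrightarrow> b \<in> C'"
    and C'sub: "C' \<subseteq> V - {v, u'}" "C' \<noteq> {}"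
    using C'(1) unfolding bad_def by blast+
  show False
  proof (cases "C' \<inter> C = {}")
    \<comment> \<open>In \<open>G - v\<close> the part \<open>C'\<close> is joined to the rest, and
      only \<open>u'\<close> can be the contact. As \<open>u'\<close> lies in \<open>C\<close> and
      \<open>u\<close> is not in \<open>C'\<close>, its neighbour in \<open>C'\<close> would lie in
      \<open>C\<close> too.\<close>
    case True
    obtain a b where ab: "a \<in> C'" "b \<in> V - {v}" "b \<notin> C'" "{a, b} \<in> edges G"
      using connE[OF two[OF v], of C'] C'sub C' uV u'V by blast
    then have "b = u'" using closed' by blast
    then have "{u', a} \<in> edges G" using ab(4) by (simp add: insert_commute)
    then show False using closed[OF u'(1), of a] True ab(1) C'sub C'(2) by blast
  next
    case False
    \<comment> \<open>Strictly smaller than \<open>C\<close>, since \<open>u'\<close> lies in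
      \<open>C\<close> but not in \<open>C'\<close>. An edge from it to a vertex other than
      \<open>v\<close> and \<open>u'\<close> cannot leave \<open>C'\<close>, and inside
      \<open>C'\<close>, which avoids \<open>u\<close>, it cannot leave \<open>C\<close>.\<close>
    have "bad u' (C' \<inter> C)"
      unfolding bad_def
    proof (intro conjI ballI)
      show "C' \<inter> C \<noteq> V - {v, u'}" using C'(2) uV u'V by blast
      fix a b assume a: "a \<in> C' \<inter> C" and b: "b \<in> V - {v, u'} - C' \<inter> C"
      show "{a, b} \<notin> edges G"
      proof
        assume "{a, b} \<in> edges G"
        then have "b \<in> C'" using closed' a b by blast
        then have "b \<in> C" using closed[of a b] a b \<open>{a, b} \<in> edges G\<close> C'(2) by blast
        with \<open>b \<in> C'\<close> b show False by blast
      qed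
    qed (use u'V u'(2) C'sub False in auto)
    moreover have "card (C' \<inter> C) < card C"
      using u'(1) C'sub C(1) fin by (intro psubset_card_mono) (auto intro: finite_subset)
    ultimately show False using least by fastforce
  qed
qed

section \<open>Vizing's theorem\<close>

definition miss :: "'a set set \<Rightarrow> ('a set \<Rightarrow> nat) \<Rightarrow> 'a \<Rightarrow> nat \<Rightarrow> bool" where
  "miss E c v \<gamma> \<longleftrightarrow> (\<forall>e\<in>E. v \<in> e \<longrightarrow> c e \<noteq> \<gamma>)"

definition edge_col :: "'a set set \<Rightarrow> nat \<Rightarrow> ('a set \<Rightarrow> nat) \<Rightarrow> bool" where
  "edge_col E k c \<longleftrightarrow>
     (\<forall>e\<in>E. \<forall>f\<in>E. e \<noteq> f \<and> e \<inter> f \<noteq> {} \<longrightarrow> c e \<noteq> c f) \<and> c ` E \<subseteq> {..<k}"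

lemma edge_colD:
  assumes "edge_col E k c" "e \<in> E" "f \<in> E" "e \<noteq> f" "e \<inter> f \<noteq> {}"
  shows "c e \<noteq> c f"
  using assms by (simp add: edge_col_def)

lemma edge_col_mono: "edge_col E k c \<Longrightarrow> F \<subseteq> E \<Longrightarrow> edge_col F k c"
  unfolding edge_col_def by (meson image_mono subsetD subset_trans)

lemma edge_col_fun_upd:
  assumes c: "edge_col E k c" and \<gamma>: "\<gamma> < k"
    and free: "\<And>f. f \<in> E \<Longrightarrow> f \<noteq> d \<Longrightarrow> d \<inter> f \<noteq> {} \<Longrightarrow> c f \<noteq> \<gamma>"
  shows "edge_col (insert d E) k (c(d := \<gamma>))"
  unfolding edge_col_def
proof (intro conjI ballI impI)
  fix e f assume e: "e \<in> insert d E" and f: "f \<in> insert d E" and ef: "e \<noteq> f \<and> e \<inter> f \<noteq> {}"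
  then consider "e = d" "f \<in> E" "f \<noteq> d" | "f = d" "e \<in> E" "e \<noteq> d" | "e \<in> E" "e \<noteq> d" "f \<in> E" "f \<noteq> d"
    by blast
  then show "(c(d := \<gamma>)) e \<noteq> (c(d := \<gamma>)) f"
  proof cases
    case 1
    then show ?thesis using free[of f] ef by simp
  next
    case 2
    then show ?thesis using free[of e] ef by (simp add: Int_commute)
  next
    case 3
    then show ?thesis using edge_colD[OF c, of e f] ef by simp
  qed
qed (use c \<gamma> in \<open>auto simp: edge_col_def\<close>)

text \<open>A Vizing fan at \<open>x\<close>: the colour of each later edge is missing at the
  preceding end, so that colours can move one place towards the head. The colour on the edge of the
  head itself is not inspected.\<close>

abbreviation fan :: "'a set set \<Rightarrow> 'a \<Rightarrow> ('a set \<Rightarrow> nat) \<Rightarrow> 'a list \<Rightarrow> bool" where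
  "fan F x c \<equiv> successively (\<lambda>y z. miss F c y (c {x, z}))"

section \<open>Shifting colours along a fan\<close>

lemma ex_miss:
  assumes "finite E" "card {e \<in> E. v \<in> e} < k"
  shows "\<exists>\<gamma><k. miss E c v \<gamma>"
proof (rule ccontr)
  assume "\<not> ?thesis"
  then have "{..<k} \<subseteq> c ` {e \<in> E. v \<in> e}" unfolding miss_def by blast
  then have "card {..<k} \<le> card {e \<in> E. v \<in> e}" using assms(1) by (intro surj_card_le) auto
  with assms(2) show False by simp
qed

text \<open>Only tail elements occur as second argument. For a fan this exempts the edge of the
  head, which may be uncoloured or carry one of the exchanged colours.\<close>

lemma successively_mono_tl:
  assumes "successively P zs"
    and "\<And>a b. b \<in> set (tl zs) \<Longrightarrow> P a b \<Longrightarrow> Q a b"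
  shows "successively Q zs"
  using assms by (induction zs rule: induct_list012) auto

text \<open>The uncoloured edge moves from \<open>xy\<close> to \<open>xz\<close>. The moved colour
  is missing at \<open>y\<close> by the fan condition; \<open>x\<close> sees the same colours as
  before, and a vertex other than \<open>x\<close> and \<open>y\<close> can only lose one, so what
  is missing there stays missing.\<close>

lemma edge_col_fan_shift:
  assumes c: "edge_col (E - {{x, y}}) k c" and yz: "y \<noteq> z" "{x, y} \<in> E" "{x, z} \<in> E"
    and miss: "miss (E - {{x, y}}) c y (c {x, z})"
  defines "c' \<equiv> c({x, y} := c {x, z})"
  shows "edge_col (E - {{x, z}}) k c'"
    and "miss (E - {{x, y}}) c x \<gamma> \<Longrightarrow> miss (E - {{x, z}}) c' x \<gamma>"
    and "w \<noteq> y \<Longrightarrow> w \<noteq> x \<Longrightarrow> miss (E - {{x, y}}) c w \<gamma> \<Longrightarrow> miss (E - {{x, z}}) c' w \<gamma>"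
proof -
  have ne: "{x, y} \<noteq> {x, z}" using yz(1) by (auto simp: doubleton_eq_iff)
  have xzE: "{x, z} \<in> E - {{x, y}}" using yz ne by blast
  have *: "c {x, z} \<noteq> c f" if "f \<in> E - {{x, z}}" "f \<noteq> {x, y}" "{x, y} \<inter> f \<noteq> {}" for f
  proof (cases "x \<in> f")
    case True
    have "f \<in> E - {{x, y}}" "{x, z} \<noteq> f" using that by auto
    moreover have "{x, z} \<inter> f \<noteq> {}" using True by blast
    ultimately show ?thesis by (rule edge_colD[OF c xzE])
  next
    case False
    then have "f \<in> E - {{x, y}}" "y \<in> f" using that by blast+
    then show ?thesis using miss unfolding miss_def by metis
  qed
  have "edge_col (insert {x, y} (E - {{x, y}, {x, z}})) k c'"
    unfolding c'_def
  proof (rule edge_col_fun_upd)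
    show "edge_col (E - {{x, y}, {x, z}}) k c" using c by (rule edge_col_mono) blast
    show "c {x, z} < k" using c xzE unfolding edge_col_def by blast
    show "c f \<noteq> c {x, z}"
      if "f \<in> E - {{x, y}, {x, z}}" "f \<noteq> {x, y}" "{x, y} \<inter> f \<noteq> {}" for f
      using *[of f] that by simp
  qed
  moreover have "insert {x, y} (E - {{x, y}, {x, z}}) = E - {{x, z}}" using yz(2) ne by auto
  ultimately show "edge_col (E - {{x, z}}) k c'" by simp
  show "miss (E - {{x, y}}) c x \<gamma> \<Longrightarrow> miss (E - {{x, z}}) c' x \<gamma>"
    using xzE unfolding miss_def c'_def by auto
  show "w \<noteq> y \<Longrightarrow> w \<noteq> x \<Longrightarrow> miss (E - {{x, y}}) c w \<gamma> \<Longrightarrow> miss (E - {{x, z}}) c' w \<gamma>"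
    unfolding miss_def c'_def by auto
qed

text \<open>Repeated shifting makes the last edge of the fan the uncoloured one, and
  \<open>\<gamma>\<close> is missing at both of its ends.\<close>

lemma edge_col_fan_rotate:
  assumes "edge_col (E - {{x, y}}) k c" "distinct (y # ys)" "x \<notin> set (y # ys)"
    and "\<forall>z\<in>set (y # ys). {x, z} \<in> E"
    and "fan (E - {{x, y}}) x c (y # ys)"
    and "\<gamma> < k" "miss (E - {{x, y}}) c x \<gamma>" "miss (E - {{x, y}}) c (last (y # ys)) \<gamma>"
  shows "\<exists>c. edge_col E k c"
  using assms
proof (induction ys arbitrary: y c)
  case Nil
  have xy: "{x, y} \<in> E" using Nil.prems by simp
  have *: "c f \<noteq> \<gamma>" if "f \<in> E - {{x, y}}" "{x, y} \<inter> f \<noteq> {}" for f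
    using that Nil.prems(7,8) unfolding miss_def by auto
  have "edge_col (insert {x, y} (E - {{x, y}})) k (c({x, y} := \<gamma>))"
    by (rule edge_col_fun_upd[OF Nil.prems(1,6)]) (use * in simp)
  then have "edge_col E k (c({x, y} := \<gamma>))" using xy by (simp add: insert_absorb)
  then show ?case by blast
next
  case (Cons z ys)
  define c' where "c' = c({x, y} := c {x, z})"
  have prem: "y \<noteq> z" "{x, y} \<in> E" "{x, z} \<in> E" "miss (E - {{x, y}}) c y (c {x, z})"
    using Cons.prems by auto
  note shift = edge_col_fan_shift[OF Cons.prems(1) prem, folded c'_def]
  have "fan (E - {{x, z}}) x c' (z # ys)"
  proof (rule successively_mono)
    show "fan (E - {{x, y}}) x c (z # ys)" using Cons.prems(5) by simp
    fix a b assume ab: "a \<in> set (z # ys)" "b \<in> set (z # ys)" "miss (E - {{x, y}}) c a (c {x, b})"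
    then have "a \<noteq> y" "a \<noteq> x" "b \<noteq> y" "b \<noteq> x" using Cons.prems(2,3) by auto
    then have "miss (E - {{x, z}}) c' a (c {x, b})" "c' {x, b} = c {x, b}"
      using shift(3) ab(3) by (auto simp: c'_def doubleton_eq_iff)
    then show "miss (E - {{x, z}}) c' a (c' {x, b})" by simp
  qed
  moreover have "miss (E - {{x, z}}) c' (last (z # ys)) \<gamma>"
  proof (rule shift(3))
    have "last (z # ys) \<in> set (z # ys)" by (rule last_in_set) simp
    then show "last (z # ys) \<noteq> y" "last (z # ys) \<noteq> x" using Cons.prems(2,3) by auto
    show "miss (E - {{x, y}}) c (last (z # ys)) \<gamma>" using Cons.prems(8) by simp
  qed
  ultimately show ?case
    using Cons.prems shift(1) shift(2)[OF Cons.prems(7)] by (intro Cons.IH[of z c']) auto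
qed

text \<open>A connected graph of maximum degree 2 is a path or a cycle and has at most two ends.
  Peeling off the end \<open>a\<close> turns its only neighbour \<open>a'\<close> into an end, which
  leaves a smaller counterexample with the ends \<open>a'\<close>, \<open>b\<close>,
  \<open>c\<close>.\<close>

lemma conn_three_ends:
  assumes "finite S" "conn G S"
    and "\<And>s u v w. \<lbrakk>s \<in> S; u \<in> S; v \<in> S; w \<in> S;
           {s, u} \<in> edges G; {s, v} \<in> edges G; {s, w} \<in> edges G\<rbrakk> \<Longrightarrow> u = v \<or> v = w \<or> u = w"
    and "a \<in> S" "b \<in> S" "c \<in> S" "a \<noteq> b" "b \<noteq> c" "a \<noteq> c"
    and "\<And>s u v. \<lbrakk>s = a \<or> s = b \<or> s = c; u \<in> S; v \<in> S; {s, u} \<in> edges G; {s, v} \<in> edges G\<rbrakk> \<Longrightarrow> u = v"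
  shows False
  using assms
proof (induction "card S" arbitrary: S a rule: less_induct)
  case less
  note fin = less.prems(1) and S = less.prems(2) and two = less.prems(3) and mem = less.prems(4-6)
    and ne = less.prems(7-9) and ends = less.prems(10)
  obtain a' where a': "a' \<in> S" "a' \<noteq> a" "{a, a'} \<in> edges G"
  proof -
    have "{a} \<subseteq> S" "{a} \<noteq> {}" "{a} \<noteq> S" using mem ne by auto
    then show ?thesis using connE[OF S] that by (metis singletonD singletonI)
  qed
  have a'a: "{a', a} \<in> edges G" using a'(3) by (simp add: insert_commute)
  have only: "u = a'" if "u \<in> S" "{a, u} \<in> edges G" for u
    using ends[of a u a'] that a' by blast
  have only': "u = a'" if "u \<in> S" "{u, a} \<in> edges G" for u
    using only that by (simp add: insert_commute)
  \<comment> \<open>If \<open>a'\<close> were itself one of the other ends, \<open>a\<close> and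
    \<open>a'\<close> would form a whole component that misses the third.\<close>
  have iso: "a' \<noteq> s" if s: "s = b \<or> s = c" for s
  proof
    assume "a' = s"
    have "{a, s} \<subseteq> S" "{a, s} \<noteq> {}" "{a, s} \<noteq> S" using mem ne s by auto
    then obtain p q where pq: "p \<in> {a, s}" "q \<in> S" "q \<notin> {a, s}" "{p, q} \<in> edges G"
      by (rule connE[OF S])
    then have "p = s" using only \<open>a' = s\<close> by blast
    then have "q = a" using ends[of s q a] s pq mem a'a \<open>a' = s\<close> by blast
    with pq show False by blast
  qed
  have conn': "conn G (S - {a})"
  proof (rule connI)
    show "S - {a} \<noteq> {}" using mem ne by blast
    fix A assume A: "A \<subseteq> S - {a}" "A \<noteq> {}" "A \<noteq> S - {a}"
    show "\<exists>p\<in>A. \<exists>q\<in>S - {a} - A. {p, q} \<in> edges G"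
    proof (cases "a' \<in> A")
      case True
      have "insert a A \<subseteq> S" "insert a A \<noteq> {}" "insert a A \<noteq> S" using A mem by auto
      then obtain p q where "p \<in> insert a A" "q \<in> S" "q \<notin> insert a A" "{p, q} \<in> edges G"
        by (rule connE[OF S])
      then show ?thesis using only True by blast
    next
      case False
      have "A \<subseteq> S" "A \<noteq> {}" "A \<noteq> S" using A mem by auto
      then obtain p q where "p \<in> A" "q \<in> S" "q \<notin> A" "{p, q} \<in> edges G"
        by (rule connE[OF S])
      then show ?thesis using only'[of p] False A by blast
    qed
  qed
  show False
  proof (rule less.hyps[of "S - {a}" a'])
    show "card (S - {a}) < card S" using mem fin by (intro psubset_card_mono) auto
    show "finite (S - {a})" using fin by simp
    show "conn G (S - {a})" by (rule conn')
    show "\<And>s u v w. \<lbrakk>s \<in> S - {a}; u \<in> S - {a}; v \<in> S - {a}; w \<in> S - {a};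
           {s, u} \<in> edges G; {s, v} \<in> edges G; {s, w} \<in> edges G\<rbrakk> \<Longrightarrow> u = v \<or> v = w \<or> u = w"
      using two by blast
    show "a' \<in> S - {a}" "b \<in> S - {a}" "c \<in> S - {a}" "a' \<noteq> b" "b \<noteq> c" "a' \<noteq> c"
      using a' mem ne iso by auto
    fix s u v assume *: "s = a' \<or> s = b \<or> s = c" "u \<in> S - {a}" "v \<in> S - {a}"
      "{s, u} \<in> edges G" "{s, v} \<in> edges G"
    show "u = v"
    proof (cases "s = a'")
      case True
      then show ?thesis using two[of a' u v a] * a' a'a mem by blast
    next
      case False
      then show ?thesis using ends[of s u v] * by blast
    qed
  qed
qed

text \<open>The component is the smallest neighbour-closed set containing \<open>x\<close>: a cut of
  it without crossing edge would leave the side of \<open>x\<close> closed, against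
  minimality.\<close>

lemma ex_component:
  assumes x: "x \<in> verts G"
  obtains C where "x \<in> C" "C \<subseteq> verts G" "conn G C"
    "\<And>a b. a \<in> C \<Longrightarrow> b \<in> verts G \<Longrightarrow> {a, b} \<in> edges G \<Longrightarrow> b \<in> C"
proof -
  define cl where "cl A \<longleftrightarrow> x \<in> A \<and> A \<subseteq> verts G \<and> (\<forall>a\<in>A. \<forall>b\<in>verts G. {a, b} \<in> edges G \<longrightarrow> b \<in> A)" for A
  define C where "C = \<Inter>{A. cl A}"
  have "cl (verts G)" using x unfolding cl_def by blast
  then have C: "cl C" unfolding C_def cl_def by blast
  have min: "C \<subseteq> A" if "cl A" for A using that unfolding C_def by blast
  have "conn G C"
  proof (rule connI)
    show "C \<noteq> {}" using C unfolding cl_def by blast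
    fix A assume A: "A \<subseteq> C" "A \<noteq> {}" "A \<noteq> C"
    show "\<exists>a\<in>A. \<exists>b\<in>C - A. {a, b} \<in> edges G"
    proof (rule ccontr)
      assume no: "\<not> ?thesis"
      have no': "\<not> (\<exists>a\<in>A. \<exists>b\<in>C - A. {b, a} \<in> edges G)" using no by (simp add: insert_commute)
      show False
      proof (cases "x \<in> A")
        case True
        then have "cl A" using no C A unfolding cl_def by blast
        then show False using min A by blast
      next
        case False
        then have "cl (C - A)" using no' C A unfolding cl_def by blast
        then show False using min A by blast
      qed
    qed
  qed
  then show ?thesis using that[of C] C unfolding cl_def by blast
qed

text \<open>A Kempe exchange carried out off \<open>C\<close> instead of on it. With
  \<open>C\<close> the component of \<open>x\<close>, every edge at \<open>x\<close> keeps its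
  colour, so a fan is disturbed only through the colours missing at its vertices.\<close>

definition swap_col :: "'a set \<Rightarrow> nat \<Rightarrow> nat \<Rightarrow> ('a set \<Rightarrow> nat) \<Rightarrow> 'a set \<Rightarrow> nat" where
  "swap_col C \<alpha> \<beta> c e =
     (if e \<inter> C \<noteq> {} then c e else if c e = \<alpha> then \<beta> else if c e = \<beta> then \<alpha> else c e)"

text \<open>Two adjacent edges coloured \<open>\<alpha>\<close> and \<open>\<beta>\<close> are both
  exchanged or both kept: if one of them meets \<open>C\<close>, it lies in \<open>C\<close>, and so
  does the common vertex.\<close>

lemma edge_col_swap:
  assumes c: "edge_col E k c" and ab: "\<alpha> < k" "\<beta> < k"
    and closed: "\<And>e. e \<in> E \<Longrightarrow> c e = \<alpha> \<or> c e = \<beta> \<Longrightarrow> e \<inter> C \<noteq> {} \<Longrightarrow> e \<subseteq> C"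
  shows "edge_col E k (swap_col C \<alpha> \<beta> c)"
  unfolding edge_col_def
proof (intro conjI ballI impI)
  fix e f assume ef: "e \<in> E" "f \<in> E" "e \<noteq> f \<and> e \<inter> f \<noteq> {}"
  then have "c e \<noteq> c f" using edge_colD[OF c] by blast
  then show "swap_col C \<alpha> \<beta> c e \<noteq> swap_col C \<alpha> \<beta> c f"
    using closed[OF ef(1)] closed[OF ef(2)] ef(3) unfolding swap_col_def
    by (auto split: if_splits)
next
  show "swap_col C \<alpha> \<beta> c ` E \<subseteq> {..<k}"
    using c ab unfolding edge_col_def swap_col_def by auto
qed

lemma miss_swap_other:
  assumes "miss E c v \<gamma>" "\<gamma> \<noteq> \<alpha>" "\<gamma> \<noteq> \<beta>"
  shows "miss E (swap_col C \<alpha> \<beta> c) v \<gamma>"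
  using assms unfolding miss_def swap_col_def by auto

lemma miss_swap_in:
  assumes "miss E c v \<gamma>" "v \<in> C"
  shows "miss E (swap_col C \<alpha> \<beta> c) v \<gamma>"
  using assms unfolding miss_def swap_col_def by auto

lemma miss_swap_out:
  assumes "miss E c v \<beta>" "v \<notin> C" "\<alpha> \<noteq> \<beta>"
    and "\<And>e. e \<in> E \<Longrightarrow> c e = \<alpha> \<or> c e = \<beta> \<Longrightarrow> e \<inter> C \<noteq> {} \<Longrightarrow> e \<subseteq> C"
  shows "miss E (swap_col C \<alpha> \<beta> c) v \<alpha>"
  using assms unfolding miss_def swap_col_def by auto

lemma edge_col_inj:
  assumes "edge_col E k c" "e \<in> E" "f \<in> E" "v \<in> e" "v \<in> f" "c e = c f"
  shows "e = f"
  using edge_colD[OF assms(1-3)] assms(4-6) by blast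

text \<open>In a maximal fan at \<open>x\<close> ending in \<open>l\<close>, let \<open>\<alpha>\<close> be missing at \<open>x\<close> and \<open>\<beta>\<close> at \<open>l\<close>. If \<open>\<beta>\<close> is
  used at \<open>x\<close>, then on a fan edge \<open>xz\<close>, so that the predecessor \<open>p\<close> of \<open>z\<close> misses \<open>\<beta>\<close> as well. The
  vertices \<open>x\<close>, \<open>p\<close>, \<open>l\<close> cannot all lie in one \<open>\<alpha>\<close>/\<open>\<beta>\<close> component, so exchanging the two colours
  outside the component of \<open>x\<close> frees \<open>\<alpha>\<close> at \<open>p\<close> or at \<open>l\<close> and keeps the fan up to there.\<close>

lemma Vizing_step:
  assumes G: "simple_graph G" and deg: "\<And>v. v \<in> verts G \<Longrightarrow> card {e \<in> edges G. v \<in> e} < k"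
    and xy: "{x, y} \<in> edges G" and c: "edge_col (edges G - {{x, y}}) k c"
  shows "\<exists>c. edge_col (edges G) k c"
proof -
  let ?E = "edges G" and ?F = "edges G - {{x, y}}"
  have finE: "finite ?E" using G by (rule simple_graph_finite_edges)
  have missV: "\<exists>\<gamma><k. miss ?F c v \<gamma>" if "v \<in> verts G" for v
  proof (rule ex_miss)
    have "card {e \<in> ?F. v \<in> e} \<le> card {e \<in> ?E. v \<in> e}" using finE by (intro card_mono) auto
    then show "card {e \<in> ?F. v \<in> e} < k" using deg[OF that] by simp
  qed (use finE in simp)
  define P where "P ys \<longleftrightarrow> distinct (y # ys) \<and> (\<forall>z\<in>set (y # ys). {x, z} \<in> ?E) \<and> fan ?F x c (y # ys)" for ys
  have "P []" using xy unfolding P_def by simp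
  moreover have "length ys \<le> card (verts G)" if "P ys" for ys
  proof -
    have "set ys \<subseteq> verts G" using that simple_graph_edge[OF G] unfolding P_def by auto
    then show ?thesis using that G distinct_card[of ys] card_mono[of "verts G" "set ys"]
      unfolding P_def simple_graph_def by auto
  qed
  ultimately obtain ys where ys: "P ys" and maxl: "\<And>zs. P zs \<Longrightarrow> length zs \<le> length ys"
    using ex_has_greatest_nat[of P "[]" length "Suc (card (verts G))"] by (metis le_imp_less_Suc)
  have dist: "distinct (y # ys)" and ysE: "\<And>z. z \<in> set (y # ys) \<Longrightarrow> {x, z} \<in> ?E"
    and f: "fan ?F x c (y # ys)" using ys unfolding P_def by blast+
  have xys: "x \<notin> set (y # ys)" using ysE simple_graph_edge(3)[OF G] by blast
  define l where "l = last (y # ys)"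
  have l: "l \<in> set (y # ys)" unfolding l_def by (rule last_in_set) simp
  have lV: "l \<in> verts G" and xV: "x \<in> verts G" using simple_graph_edge[OF G ysE[OF l]] by blast+
  obtain \<alpha> where \<alpha>: "\<alpha> < k" "miss ?F c x \<alpha>" using missV[OF xV] by blast
  obtain \<beta> where \<beta>: "\<beta> < k" "miss ?F c l \<beta>" using missV[OF lV] by blast
  show ?thesis
  proof (cases "miss ?F c x \<beta>")
    case True
    then show ?thesis
      using edge_col_fan_rotate[OF c dist xys _ f \<beta>(1)] ysE \<beta>(2) unfolding l_def by blast
  next
    case False
    then obtain e where e: "e \<in> ?F" "x \<in> e" "c e = \<beta>" unfolding miss_def by blast
    then obtain z where z: "e = {x, z}" using simple_graph_edgeE[OF G, of e] by blast
    have ab: "\<alpha> \<noteq> \<beta>" using e \<alpha>(2) unfolding miss_def by blast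
    have zy: "z \<noteq> y" using e z by blast
    \<comment> \<open>The colour of \<open>xz\<close> is missing at the last vertex of the fan, so a
      new \<open>z\<close> would prolong the fan.\<close>
    have zys: "z \<in> set ys"
    proof (rule ccontr)
      assume "z \<notin> set ys"
      then have "P (ys @ [z])"
        using ys zy e z \<beta>(2) l_def unfolding P_def
        by (auto simp: successively_append_iff simp flip: append_Cons)
      then show False using maxl by fastforce
    qed
    have zl: "z \<noteq> l" using \<beta>(2) e z unfolding miss_def by blast
    obtain as p bs where split: "y # ys = as @ p # z # bs"
    proof -
      obtain us vs where uv: "y # ys = us @ z # vs" using zys by (meson list.set_intros(2) split_list)
      then have "us \<noteq> []" using zy by auto
      then show ?thesis using that uv by (metis append_butlast_last_id append_Cons append_assoc append_Nil)
    qed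
    have pmiss: "miss ?F c p \<beta>"
      using f e(3) z unfolding split by (simp add: successively_append_iff)
    have pl: "p \<noteq> l"
    proof -
      have "l \<in> set (z # bs)" unfolding l_def split by simp
      then show ?thesis using dist unfolding split by auto
    qed
    have pys: "p \<in> set (y # ys)" unfolding split by simp
    have pV: "p \<in> verts G" using simple_graph_edge[OF G ysE[OF pys]] by blast
    define K where "K = Graph (verts G) {e \<in> ?F. c e = \<alpha> \<or> c e = \<beta>}"
    obtain C where C: "x \<in> C" "C \<subseteq> verts G" "conn K C"
      "\<And>a b. a \<in> C \<Longrightarrow> b \<in> verts G \<Longrightarrow> {a, b} \<in> edges K \<Longrightarrow> b \<in> C"
      using ex_component[of x K] xV by (auto simp: K_def)
    have finC: "finite C" using C(2) G finite_subset unfolding simple_graph_def by blast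
    have closed: "e \<subseteq> C" if "e \<in> ?F" "c e = \<alpha> \<or> c e = \<beta>" "e \<inter> C \<noteq> {}" for e
    proof -
      obtain u v where uv: "e = {u, v}" "u \<in> verts G" "v \<in> verts G"
        using simple_graph_edgeE[OF G, of e] \<open>e \<in> ?F\<close> by blast
      have "{u, v} \<in> edges K" "{v, u} \<in> edges K" using that uv by (auto simp: K_def insert_commute)
      then show ?thesis using C(4)[of u v] C(4)[of v u] uv that(3) by blast
    qed
    have same: "u = v" if "{s, u} \<in> ?F" "{s, v} \<in> ?F" "c {s, u} = c {s, v}" for s u v
    proof -
      have "{s, u} = {s, v}" using edge_col_inj[OF c that(1,2) _ _ that(3)] by blast
      then show ?thesis by (auto simp: doubleton_eq_iff)
    qed
    \<comment> \<open>In \<open>K\<close> the vertex \<open>x\<close> lacks \<open>\<alpha>\<close>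
      and both \<open>p\<close> and \<open>l\<close> lack \<open>\<beta>\<close>, so these would be
      three ends in a connected set of maximum degree 2.\<close>
    have three: "\<not> (p \<in> C \<and> l \<in> C)"
    proof
      assume pl': "p \<in> C \<and> l \<in> C"
      show False
      proof (rule conn_three_ends[OF finC C(3)])
        show "x \<in> C" "p \<in> C" "l \<in> C" "x \<noteq> p" "p \<noteq> l" "x \<noteq> l"
          using C(1) pl' pl pys l xys by auto
        show "u = v \<or> v = w \<or> u = w"
          if "{s, u} \<in> edges K" "{s, v} \<in> edges K" "{s, w} \<in> edges K" for s u v w
        proof -
          have "{s, u} \<in> ?F" "{s, v} \<in> ?F" "{s, w} \<in> ?F" "c {s, u} = \<alpha> \<or> c {s, u} = \<beta>"
            "c {s, v} = \<alpha> \<or> c {s, v} = \<beta>" "c {s, w} = \<alpha> \<or> c {s, w} = \<beta>"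
            using that unfolding K_def graph.sel by blast+
          then show ?thesis using same[of s u v] same[of s v w] same[of s u w] by metis
        qed
        show "u = v" if "s = x \<or> s = p \<or> s = l" "{s, u} \<in> edges K" "{s, v} \<in> edges K" for s u v
        proof -
          have F: "{s, u} \<in> ?F" "{s, v} \<in> ?F" "c {s, u} = \<alpha> \<or> c {s, u} = \<beta>"
            "c {s, v} = \<alpha> \<or> c {s, v} = \<beta>"
            using that unfolding K_def graph.sel by blast+
          moreover have "miss ?F c s \<alpha> \<or> miss ?F c s \<beta>" using that(1) \<alpha>(2) \<beta>(2) pmiss by blast
          ultimately have "c {s, u} = c {s, v}" unfolding miss_def by (metis insertI1)
          then show ?thesis using same F by blast
        qed
      qed
    qed
    define c' where "c' = swap_col C \<alpha> \<beta> c"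
    have c': "edge_col ?F k c'" unfolding c'_def using edge_col_swap[OF c \<alpha>(1) \<beta>(1)] closed by blast
    have c'x: "c' {x, w} = c {x, w}" for w unfolding c'_def swap_col_def using C(1) by auto
    have xmiss: "miss ?F c' x \<alpha>" unfolding c'_def using \<alpha>(2) C(1) by (rule miss_swap_in)
    have out: "miss ?F c' w \<alpha>" if "miss ?F c w \<beta>" "w \<notin> C" for w
      unfolding c'_def using miss_swap_out[OF that ab] closed by blast
    \<comment> \<open>Apart from \<open>y\<close>, whose edge is uncoloured, and \<open>z\<close>,
      the fan edges carry neither colour: \<open>\<alpha>\<close> is missing at \<open>x\<close>,
      and \<open>xz\<close> is the edge at \<open>x\<close> coloured \<open>\<beta>\<close>. Their
      links are therefore unaffected by the exchange.\<close>
    have fan': "fan ?F x c' zs"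
      if zs: "fan ?F x c zs" "set zs \<subseteq> set (y # ys)" "y \<notin> set (tl zs)" "z \<notin> set (tl zs)" for zs
    proof (rule successively_mono_tl[OF zs(1)])
      fix a b assume b: "b \<in> set (tl zs)" and m: "miss ?F c a (c {x, b})"
      have "b \<in> set zs" using b by (cases zs) auto
      then have "b \<noteq> y" "b \<noteq> z" "{x, b} \<in> ?E" using b zs ysE by auto
      then have "{x, b} \<in> ?F" by (auto simp: doubleton_eq_iff)
      moreover have "{x, z} \<in> ?F" using e(1) z by simp
      ultimately have "c {x, b} \<noteq> \<beta>" "c {x, b} \<noteq> \<alpha>"
        using same[of x b z] \<open>b \<noteq> z\<close> e(3) z \<alpha>(2) unfolding miss_def by auto
      then show "miss ?F c' a (c' {x, b})"
        unfolding c'x unfolding c'_def by (intro miss_swap_other[OF m])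
    qed
    have yz: "y \<notin> set (tl (as @ [p]))" "z \<notin> set (tl (as @ [p]))" "y \<notin> set bs" "z \<notin> set bs"
      using dist split zy by (cases as; auto)+
    have f_split: "fan ?F x c (as @ [p])" "fan ?F x c (z # bs)"
      using f unfolding split by (auto simp: successively_append_iff)
    have sub: "set (as @ [p]) \<subseteq> set (y # ys)" "set (z # bs) \<subseteq> set (y # ys)"
      unfolding split by auto
    have fan1: "fan ?F x c' (as @ [p])" using fan'[OF f_split(1) sub(1)] yz by blast
    have fan2: "fan ?F x c' (z # bs)" using fan'[OF f_split(2) sub(2)] yz by simp
    show ?thesis
    proof (cases "p \<in> C")
      case True
      then have "l \<notin> C" using three by blast
      then have "miss ?F c' (last (y # ys)) \<alpha>" using out[OF \<beta>(2)] unfolding l_def by blast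
      \<comment> \<open>The link from \<open>p\<close> to \<open>z\<close> is the one that uses
        \<open>\<beta>\<close>. It survives because \<open>p\<close> lies in \<open>C\<close>, where
        no colour changes.\<close>
      moreover have "miss ?F c' p (c' {x, z})"
        unfolding c'x using pmiss True e(3) z unfolding c'_def by (metis miss_swap_in)
      then have "fan ?F x c' (y # ys)"
        using fan1 fan2 unfolding split by (auto simp: successively_append_iff)
      ultimately show ?thesis
        using edge_col_fan_rotate[OF c' dist xys _ _ \<alpha>(1) xmiss] ysE by blast
    next
      case False
      obtain ps where ps: "as @ [p] = y # ps" using split by (cases as) auto
      then have "last (y # ps) = p" by (metis last_snoc)
      then have "miss ?F c' (last (y # ps)) \<alpha>" using out[OF pmiss False] by simp
      moreover have "distinct (y # ps)" "x \<notin> set (y # ps)"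
        using dist xys sub(1) unfolding ps[symmetric] split by auto
      moreover have "\<forall>w\<in>set (y # ps). {x, w} \<in> ?E" using ysE sub(1) unfolding ps by blast
      ultimately show ?thesis
        using edge_col_fan_rotate[OF c' _ _ _ _ \<alpha>(1) xmiss] fan1 unfolding ps by blast
    qed
  qed
qed

lemma Vizing:
  assumes G: "simple_graph G" and deg: "\<And>v. v \<in> verts G \<Longrightarrow> card {e \<in> edges G. v \<in> e} < k"
  shows "\<exists>c. edge_col (edges G) k c"
proof -
  have fin: "finite (edges G)" using G by (rule simple_graph_finite_edges)
  have "E \<subseteq> edges G \<Longrightarrow> \<exists>c. edge_col E k c" if "finite E" for E
    using that
  proof (induction E)
    case empty
    then show ?case by (simp add: edge_col_def)
  next
    case (insert e E)
    let ?H = "Graph (verts G) (insert e E)"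
    have H: "simple_graph ?H" using G insert.prems unfolding simple_graph_def by auto
    have "e \<in> edges G" using insert.prems by simp
    then obtain x y where e: "e = {x, y}" using simple_graph_edgeE[OF G] by metis
    obtain c where c: "edge_col E k c" using insert by blast
    have "\<exists>c. edge_col (edges ?H) k c"
    proof (rule Vizing_step[OF H])
      show "{x, y} \<in> edges ?H" using e by simp
      show "edge_col (edges ?H - {{x, y}}) k c" using c by (rule edge_col_mono) (auto simp: e)
      fix v assume "v \<in> verts ?H"
      then have "card {e \<in> edges G. v \<in> e} < k" using deg by simp
      moreover have "card {f \<in> edges ?H. v \<in> f} \<le> card {e \<in> edges G. v \<in> e}"
        using insert.prems fin by (intro card_mono) auto
      ultimately show "card {f \<in> edges ?H. v \<in> f} < k" by simp
    qed
    then show ?case by simp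
  qed
  then show ?thesis using fin by blast
qed

section \<open>Total colourings\<close>

definition degree :: "'a graph \<Rightarrow> 'a \<Rightarrow> nat" where
  "degree G v = card {e \<in> edges G. v \<in> e}"

lemma edges_at_eq:
  assumes "simple_graph G"
  shows "{e \<in> edges G. v \<in> e} = (\<lambda>u. {v, u}) ` {u. {v, u} \<in> edges G}"
proof (intro equalityI subsetI)
  fix e assume "e \<in> {e \<in> edges G. v \<in> e}"
  then obtain a b where "e = {a, b}" "e \<in> edges G" "v \<in> e"
    using simple_graph_edgeE[OF assms] by (metis (no_types, lifting) mem_Collect_eq)
  then show "e \<in> (\<lambda>u. {v, u}) ` {u. {v, u} \<in> edges G}"
    by (auto simp: insert_commute)
qed auto

lemma card_neighbours:
  assumes "simple_graph G"
  shows "card {u. {v, u} \<in> edges G} = degree G v"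
  unfolding degree_def edges_at_eq[OF assms]
  by (rule card_image[symmetric]) (auto simp: inj_on_def doubleton_eq_iff)

lemma finite_neighbours:
  assumes "simple_graph G"
  shows "finite {u. {v, u} \<in> edges G}"
proof (rule finite_subset)
  show "{u. {v, u} \<in> edges G} \<subseteq> verts G" using simple_graph_edge[OF assms] by blast
  show "finite (verts G)" using assms by (simp add: simple_graph_def)
qed

lemma ex_neighbour_notin:
  assumes "simple_graph G" "finite X" "card X < degree G v"
  obtains u where "{v, u} \<in> edges G" "u \<notin> X"
proof -
  have "\<not> {u. {v, u} \<in> edges G} \<subseteq> X"
    using card_mono[OF assms(2), of "{u. {v, u} \<in> edges G}"] assms(3)
      card_neighbours[OF assms(1), of v] by linarith
  then show ?thesis using that by blast
qed

lemma ex_colour_notin: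
  assumes "finite X" "card X < k"
  obtains \<gamma> :: nat where "\<gamma> < k" "\<gamma> \<notin> X"
proof -
  have "\<not> {..<k} \<subseteq> X" using card_mono[OF assms(1), of "{..<k}"] assms(2) by auto
  then show ?thesis using that by blast
qed

text \<open>A colouring of the total graph, split into vertex part and edge part so that each can be
  changed by itself.\<close>

definition total_col :: "'a graph \<Rightarrow> ('a \<Rightarrow> nat) \<Rightarrow> ('a set \<Rightarrow> nat) \<Rightarrow> bool" where
  "total_col G f g \<longleftrightarrow> (\<forall>u v. {u, v} \<in> edges G \<longrightarrow> f u \<noteq> f v) \<and> proper_edge_coloring G g \<and>
     (\<forall>e\<in>edges G. \<forall>v\<in>e. f v \<noteq> g e)"

definition total_colorable :: "'a graph \<Rightarrow> nat \<Rightarrow> bool" where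
  "total_colorable G k \<longleftrightarrow>
     (\<exists>f g. total_col G f g \<and> f ` verts G \<subseteq> {..<k} \<and> g ` edges G \<subseteq> {..<k})"

lemma total_colI:
  assumes "\<And>u v. {u, v} \<in> edges G \<Longrightarrow> f u \<noteq> f v"
    and "\<And>d e. d \<in> edges G \<Longrightarrow> e \<in> edges G \<Longrightarrow> d \<noteq> e \<Longrightarrow> d \<inter> e \<noteq> {} \<Longrightarrow> g d \<noteq> g e"
    and "\<And>e v. e \<in> edges G \<Longrightarrow> v \<in> e \<Longrightarrow> f v \<noteq> g e"
  shows "total_col G f g"
  using assms by (simp add: total_col_def proper_edge_coloring_def)

lemma total_colD:
  assumes "total_col G f g"
  shows "{u, v} \<in> edges G \<Longrightarrow> f u \<noteq> f v"
    and "d \<in> edges G \<Longrightarrow> e \<in> edges G \<Longrightarrow> d \<noteq> e \<Longrightarrow> d \<inter> e \<noteq> {} \<Longrightarrow> g d \<noteq> g e"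
    and "e \<in> edges G \<Longrightarrow> v \<in> e \<Longrightarrow> f v \<noteq> g e"
  using assms by (simp_all add: total_col_def proper_edge_coloring_def)

lemma total_colorableI:
  assumes "total_col G f g" "\<And>v. v \<in> verts G \<Longrightarrow> f v < k" "\<And>e. e \<in> edges G \<Longrightarrow> g e < k"
  shows "total_colorable G k"
  unfolding total_colorable_def using assms by (intro exI[of _ f] exI[of _ g]) auto

lemma total_colorableE:
  assumes "total_colorable G k"
  obtains f g where "total_col G f g" "\<forall>v\<in>verts G. f v < k" "\<forall>e\<in>edges G. g e < k"
proof -
  from assms obtain f g where "total_col G f g" "f ` verts G \<subseteq> {..<k}" "g ` edges G \<subseteq> {..<k}"
    unfolding total_colorable_def by (elim exE conjE)
  then show ?thesis by (intro that[of f g]) auto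
qed

lemma chromatic_number_total_graph_le:
  assumes "total_colorable G k"
  shows "chromatic_number (total_graph G) \<le> k"
proof -
  obtain f g where fg: "total_col G f g" and f: "\<forall>v\<in>verts G. f v < k"
    and g: "\<forall>e\<in>edges G. g e < k"
    using assms by (rule total_colorableE)
  have "proper_coloring (total_graph G) (case_sum f g)"
    unfolding proper_coloring_def
  proof (intro ballI impI)
    fix a b assume "{a, b} \<in> edges (total_graph G)"
    then consider
        u v where "{a, b} = {Inl u, Inl v}" "{u, v} \<in> edges G"
      | d e where "{a, b} = {Inr d, Inr e}" "d \<in> edges G" "e \<in> edges G" "d \<noteq> e" "d \<inter> e \<noteq> {}"
      | v e where "{a, b} = {Inl v, Inr e}" "e \<in> edges G" "v \<in> e"
      by (rule total_graph_edgeE)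
    then show "case_sum f g a \<noteq> case_sum f g b"
    proof cases
      case 1
      then show ?thesis using total_colD(1)[OF fg 1(2)] by (auto simp: doubleton_eq_iff)
    next
      case 2
      then show ?thesis using total_colD(2)[OF fg 2(2-5)] by (auto simp: doubleton_eq_iff)
    next
      case 3
      then show ?thesis using total_colD(3)[OF fg 3(2,3)] by (auto simp: doubleton_eq_iff)
    qed
  qed
  moreover have "case_sum f g ` verts (total_graph G) \<subseteq> {..<k}"
    using f g by (auto simp: total_graph_def)
  ultimately show ?thesis unfolding chromatic_number_def by (intro Least_le) blast
qed

section \<open>Greedy colouring and colouring from lists\<close>

lemma ex_greedy_coloring:
  assumes G: "simple_graph G" and deg: "\<And>v. v \<in> verts G \<Longrightarrow> degree G v < k"
  obtains f where "\<forall>u v. {u, v} \<in> edges G \<longrightarrow> f u \<noteq> f v" "\<forall>v\<in>verts G. f v < k"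
proof -
  have "S \<subseteq> verts G \<Longrightarrow> \<exists>f. (\<forall>u\<in>S. \<forall>v\<in>S. {u, v} \<in> edges G \<longrightarrow> f u \<noteq> f v) \<and> (\<forall>v\<in>S. f v < k)"
    if "finite S" for S
    using that
  proof (induction S)
    case (insert x S)
    then obtain f where f: "\<forall>u\<in>S. \<forall>v\<in>S. {u, v} \<in> edges G \<longrightarrow> f u \<noteq> f v"
      "\<forall>v\<in>S. f v < k" by auto
    have "card (f ` {u. {x, u} \<in> edges G}) < k"
      using card_image_le[OF finite_neighbours[OF G], of f x] card_neighbours[OF G, of x]
        deg[of x] insert.prems by simp
    then obtain \<gamma> where \<gamma>: "\<gamma> < k" "\<gamma> \<notin> f ` {u. {x, u} \<in> edges G}"
      by (rule ex_colour_notin[OF finite_imageI[OF finite_neighbours[OF G]]])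
    show ?case
    proof (intro exI[of _ "f(x := \<gamma>)"] conjI ballI impI)
      fix u v assume uv: "u \<in> insert x S" "v \<in> insert x S" "{u, v} \<in> edges G"
      then have "u \<noteq> v" "{v, u} \<in> edges G"
        using simple_graph_edge(3)[OF G] by (auto simp: insert_commute)
      then show "(f(x := \<gamma>)) u \<noteq> (f(x := \<gamma>)) v"
        using uv f(1) \<gamma>(2) by auto
    qed (use f \<gamma>(1) in auto)
  qed simp
  moreover have "finite (verts G)" using G by (simp add: simple_graph_def)
  ultimately obtain f where "\<forall>u\<in>verts G. \<forall>v\<in>verts G. {u, v} \<in> edges G \<longrightarrow> f u \<noteq> f v"
    "\<forall>v\<in>verts G. f v < k" by blast
  then show ?thesis using that simple_graph_edge[OF G] by metis
qed

lemma ex_inj_choice: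
  assumes "finite E" "\<And>e. e \<in> E \<Longrightarrow> finite (L e) \<and> card E \<le> card (L e)"
  shows "\<exists>c. inj_on c E \<and> (\<forall>e\<in>E. c e \<in> L e)"
proof -
  have "F \<subseteq> E \<Longrightarrow> \<exists>c. inj_on c F \<and> (\<forall>e\<in>F. c e \<in> L e)" if "finite F" for F
    using that
  proof (induction F)
    case (insert e F)
    then obtain c where c: "inj_on c F" "\<forall>e\<in>F. c e \<in> L e" by auto
    have "card (c ` F) < card (insert e F)" using insert.hyps card_image_le[of F c] by simp
    also have "\<dots> \<le> card (L e)" using card_mono[OF assms(1) insert.prems] assms(2)[of e] insert.prems by simp
    finally have "\<not> L e \<subseteq> c ` F" using card_mono[of "c ` F" "L e"] insert.hyps by force
    then obtain x where "x \<in> L e" "x \<notin> c ` F" by blast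
    then have "inj_on (c(e := x)) (insert e F) \<and> (\<forall>d\<in>insert e F. (c(e := x)) d \<in> L d)"
      using c insert.hyps by (auto simp: inj_on_def)
    then show ?case by blast
  qed simp
  then show ?thesis using assms(1) by blast
qed

text \<open>Lists as long as the number of edges allow distinct colours on all edges. This
  guarantees that the least value in \<open>edge_choosability\<close> is attained.\<close>

lemma edge_choosable_card_edges:
  assumes "finite (edges G)"
  shows "edge_choosable G (card (edges G))"
  unfolding edge_choosable_def
proof (intro allI impI)
  fix L :: "'a set \<Rightarrow> nat set"
  assume "\<forall>e\<in>edges G. finite (L e) \<and> card (L e) = card (edges G)"
  then obtain c where "inj_on c (edges G)" "\<forall>e\<in>edges G. c e \<in> L e"
    using ex_inj_choice[OF assms, of L] by auto
  then show "\<exists>c. proper_edge_coloring G c \<and> (\<forall>e\<in>edges G. c e \<in> L e)"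
    unfolding proper_edge_coloring_def by (metis inj_onD)
qed

lemma edge_choosable_edge_choosability:
  "finite (edges G) \<Longrightarrow> edge_choosable G (edge_choosability G)"
  unfolding edge_choosability_def by (rule LeastI) (rule edge_choosable_card_edges)

lemma chromatic_index_le:
  assumes G: "simple_graph G" and deg: "\<And>v. v \<in> verts G \<Longrightarrow> degree G v < k"
  shows "chromatic_index G \<le> k"
proof -
  obtain c where "edge_col (edges G) k c"
    using Vizing[OF G] deg unfolding degree_def by blast
  then have "proper_edge_coloring G c \<and> c ` edges G \<subseteq> {..<k}"
    by (simp add: edge_col_def proper_edge_coloring_def)
  then show ?thesis unfolding chromatic_index_def by (intro Least_le) blast
qed

text \<open>\<open>D + 3\<close> is Vizing's bound \<open>D + 1\<close>, which carries over to lists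
  by the equality of the two indices, plus the two colours that the ends of an edge block.\<close>

lemma total_colorable_of_edge_choosability:
  assumes G: "simple_graph G" and deg: "\<And>v. v \<in> verts G \<Longrightarrow> degree G v \<le> D"
    and ch: "edge_choosability G = chromatic_index G" and k: "D + 3 \<le> k"
  shows "total_colorable G k"
proof -
  have fin: "finite (edges G)" using G by (rule simple_graph_finite_edges)
  have "\<And>v. v \<in> verts G \<Longrightarrow> degree G v < D + 1" using deg by fastforce
  then have ch_le: "edge_choosability G \<le> D + 1" unfolding ch by (rule chromatic_index_le[OF G])
  have "\<And>v. v \<in> verts G \<Longrightarrow> degree G v < k" using deg k by fastforce
  then obtain f where f: "\<forall>u v. {u, v} \<in> edges G \<longrightarrow> f u \<noteq> f v" "\<forall>v\<in>verts G. f v < k"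
    by (rule ex_greedy_coloring[OF G])
  have "\<exists>A\<subseteq>{..<k} - f ` e. card A = edge_choosability G" if "e \<in> edges G" for e
  proof -
    have e: "finite e" "card e = 2" using G that card_eq_0_iff[of e]
      unfolding simple_graph_def by force+
    have "card {..<k} - card (f ` e) \<le> card ({..<k} - f ` e)"
      using e(1) by (intro diff_card_le_card_Diff) auto
    moreover have "card (f ` e) \<le> 2" using card_image_le[OF e(1), of f] e(2) by simp
    ultimately have "edge_choosability G \<le> card ({..<k} - f ` e)" using ch_le k by simp
    then show ?thesis by (metis obtain_subset_with_card_n)
  qed
  then obtain L where L: "\<And>e. e \<in> edges G \<Longrightarrow> L e \<subseteq> {..<k} - f ` e \<and> card (L e) = edge_choosability G"
    by metis
  then have "\<forall>e\<in>edges G. finite (L e) \<and> card (L e) = edge_choosability G"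
    by (meson finite_Diff finite_lessThan finite_subset)
  then have "\<exists>g. proper_edge_coloring G g \<and> (\<forall>e\<in>edges G. g e \<in> L e)"
    using edge_choosable_edge_choosability[OF fin] unfolding edge_choosable_def by simp
  then obtain g where g: "proper_edge_coloring G g" "\<And>e. e \<in> edges G \<Longrightarrow> g e \<in> L e" by blast
  show ?thesis
  proof (rule total_colorableI)
    show "total_col G f g"
    proof (rule total_colI)
      show "f v \<noteq> g e" if "e \<in> edges G" "v \<in> e" for e v
        using L[OF that(1)] g(2)[OF that(1)] imageI[OF that(2), of f] by force
      show "g d \<noteq> g e" if "d \<in> edges G" "e \<in> edges G" "d \<noteq> e" "d \<inter> e \<noteq> {}" for d e
        using g(1) that by (simp add: proper_edge_coloring_def)
    qed (use f(1) in blast)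
    show "g e < k" if "e \<in> edges G" for e using L[OF that] g(2)[OF that] by blast
  qed (use f(2) in blast)
qed

text \<open>Meant for recolouring: a permutation of the palette with prescribed values on the few
  colours seen at one vertex.\<close>

lemma ex_bij_betw_extending:
  assumes "finite S" "A \<subseteq> S" "inj_on h A" "h ` A \<subseteq> S"
  obtains \<pi> where "bij_betw \<pi> S S" "\<And>a. a \<in> A \<Longrightarrow> \<pi> a = h a"
proof -
  have "card (S - A) = card (S - h ` A)"
    using assms by (simp add: card_Diff_subset finite_subset card_image)
  then obtain j where j: "bij_betw j (S - A) (S - h ` A)"
    using finite_same_card_bij[of "S - A" "S - h ` A"] assms(1) by blast
  define \<pi> where "\<pi> = (\<lambda>x. if x \<in> A then h x else j x)"
  have "bij_betw \<pi> A (h ` A)" "bij_betw \<pi> (S - A) (S - h ` A)"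
    using assms(3) j bij_betw_cong[of A \<pi> h] bij_betw_cong[of "S - A" \<pi> j]
    by (auto simp: \<pi>_def bij_betw_def)
  then have "bij_betw \<pi> (A \<union> (S - A)) (h ` A \<union> (S - h ` A))" by (rule bij_betw_combine) blast
  moreover have "A \<union> (S - A) = S" "h ` A \<union> (S - h ` A) = S" using assms by blast+
  ultimately show ?thesis using that[of \<pi>] by (simp add: \<pi>_def)
qed

text \<open>Criticality covers all proper subgraphs because two kinds occur: the connectivity
  argument colours induced subgraphs, the degree argument a graph with one edge less.\<close>

locale total_critical =
  fixes G :: "'a graph" and k :: nat
  assumes simple: "simple_graph G"
    and not_colorable: "\<not> total_colorable G k"
    and critical: "\<And>H. subgraph H G \<Longrightarrow> H \<noteq> G \<Longrightarrow> total_colorable H k"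
begin

section \<open>Connectivity and degrees in critical graphs\<close>

lemma finite_verts: "finite (verts G)"
  using simple by (simp add: simple_graph_def)

lemma finite_edges_at: "finite {e \<in> edges G. v \<in> e}"
  using simple_graph_finite_edges[OF simple] by simp

lemma edgeE:
  assumes "e \<in> edges G" "v \<in> e"
  obtains u where "e = {v, u}" "u \<noteq> v" "u \<in> verts G" "v \<in> verts G"
proof -
  obtain a b where ab: "e = {a, b}" "a \<noteq> b" "a \<in> verts G" "b \<in> verts G"
    using simple assms(1) by (rule simple_graph_edgeE)
  then consider "v = a" | "v = b" using assms(2) by blast
  then show ?thesis using that[of a] that[of b] ab by cases (auto simp: insert_commute)
qed

lemma edge_eqI:
  assumes e: "e \<in> edges G" and ab: "a \<in> e" "b \<in> e" "a \<noteq> b"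
  shows "e = {a, b}"
proof -
  obtain u where "e = {a, u}" using e ab(1) by (rule edgeE)
  then show ?thesis using ab by simp
qed

lemma edge_not_subset_singleton:
  assumes "e \<in> edges G"
  shows "\<not> e \<subseteq> {v}"
proof -
  obtain a b where "e = {a, b}" "a \<noteq> b" using simple assms by (rule simple_graph_edgeE)
  then show ?thesis by blast
qed

lemma induced_colorable:
  assumes "S \<subseteq> verts G" "S \<noteq> verts G"
  obtains f g where "total_col (Graph S {e \<in> edges G. e \<subseteq> S}) f g"
    "\<forall>v\<in>S. f v < k" "\<forall>e\<in>edges G. e \<subseteq> S \<longrightarrow> g e < k"
proof -
  let ?H = "Graph S {e \<in> edges G. e \<subseteq> S}"
  have "subgraph ?H G" using assms simple finite_subset[OF assms(1)]
    unfolding subgraph_def simple_graph_def by auto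
  moreover have "?H \<noteq> G" using assms(2) by (metis graph.sel(1))
  ultimately have "total_colorable ?H k" by (rule critical)
  then show ?thesis by (rule total_colorableE) (rule that, auto)
qed

text \<open>At a cut vertex the colours on one side can be permuted so that both sides agree on the
  vertex and use different colours on the edges at it.\<close>

lemma conn_delete_vertex:
  assumes v: "v \<in> verts G" and deg: "degree G v < k" and ne: "verts G \<noteq> {v}"
  shows "conn G (verts G - {v})"
proof (rule connI)
  show "verts G - {v} \<noteq> {}" using v ne by blast
next
  fix C assume C: "C \<subseteq> verts G - {v}" "C \<noteq> {}" "C \<noteq> verts G - {v}"
  let ?C1 = "insert v C" and ?C2 = "verts G - C"
  let ?E1 = "{e \<in> edges G. e \<subseteq> ?C1}" and ?E2 = "{e \<in> edges G. e \<subseteq> ?C2}"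
  let ?S1 = "{e \<in> ?E1. v \<in> e}" and ?S2 = "{e \<in> ?E2. v \<in> e}"
  show "\<exists>a\<in>C. \<exists>b\<in>verts G - {v} - C. {a, b} \<in> edges G"
  proof (rule ccontr)
    assume "\<not> ?thesis"
    then have no: "\<And>a b. a \<in> C \<Longrightarrow> b \<in> verts G - {v} - C \<Longrightarrow> {a, b} \<notin> edges G" by blast
    have cover: "e \<subseteq> ?C1 \<or> e \<subseteq> ?C2" if e: "e \<in> edges G" for e
    proof (rule ccontr)
      assume neg: "\<not> ?thesis"
      have "e \<subseteq> verts G" using e simple unfolding simple_graph_def by blast
      then obtain a b where ab: "a \<in> e" "a \<in> C" "b \<in> e" "b \<in> verts G - {v} - C"
        using neg by blast
      then have "e = {a, b}" using edge_eqI[OF e, of a b] by blast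
      then show False using no ab e by blast
    qed
    have disj: "\<not> (e \<subseteq> ?C1 \<and> e \<subseteq> ?C2)" if "e \<in> edges G" for e
    proof
      assume "e \<subseteq> ?C1 \<and> e \<subseteq> ?C2"
      then have "e \<subseteq> {v}" by blast
      then show False using edge_not_subset_singleton[OF that] by blast
    qed
    have C1: "?C1 \<subseteq> verts G" "?C1 \<noteq> verts G" and C2: "?C2 \<subseteq> verts G" "?C2 \<noteq> verts G"
      using C v by auto
    obtain f1 g1 where c1: "total_col (Graph ?C1 ?E1) f1 g1"
      and "\<forall>w\<in>?C1. f1 w < k" "\<forall>e\<in>edges G. e \<subseteq> ?C1 \<longrightarrow> g1 e < k"
      using C1 by (rule induced_colorable)
    then have b1: "\<And>w. w \<in> ?C1 \<Longrightarrow> f1 w < k" "\<And>e. e \<in> edges G \<Longrightarrow> e \<subseteq> ?C1 \<Longrightarrow> g1 e < k"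
      by blast+
    obtain f2 g2 where c2: "total_col (Graph ?C2 ?E2) f2 g2"
      and "\<forall>w\<in>?C2. f2 w < k" "\<forall>e\<in>edges G. e \<subseteq> ?C2 \<longrightarrow> g2 e < k"
      using C2 by (rule induced_colorable)
    then have b2: "\<And>w. w \<in> ?C2 \<Longrightarrow> f2 w < k" "\<And>e. e \<in> edges G \<Longrightarrow> e \<subseteq> ?C2 \<Longrightarrow> g2 e < k"
      by blast+
    note c1 = total_colD[OF c1, unfolded graph.sel] and c2 = total_colD[OF c2, unfolded graph.sel]
    have vC2: "v \<in> ?C2" using C v by blast
    have fin: "finite ?S1" "finite ?S2" using finite_edges_at[of v] by (auto elim: rev_finite_subset)
    have "?S1 \<inter> ?S2 = {}" using disj by blast
    then have "card ?S1 + card ?S2 = card (?S1 \<union> ?S2)" using fin by (simp add: card_Un_disjoint)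
    also have "\<dots> \<le> degree G v" unfolding degree_def by (intro card_mono finite_edges_at) auto
    finally have S12: "card ?S1 + card ?S2 < k" using deg by simp
    \<comment> \<open>The colours that edges of the second side may receive at \<open>v\<close>.
      There are at least \<open>k - 1 - card ?S1\<close> of them, enough for \<open>?S2\<close>
      because \<open>card ?S1 + card ?S2 < k\<close>.\<close>
    let ?T = "{..<k} - insert (f1 v) (g1 ` ?S1)"
    have "card (insert (f1 v) (g1 ` ?S1)) \<le> Suc (card ?S1)"
      using card_insert_le_m1 card_image_le[OF fin(1), of g1] fin(1)
      by (metis (no_types, lifting) Suc_le_mono card_insert_if finite_imageI le_SucI)
    moreover have "card {..<k} - card (insert (f1 v) (g1 ` ?S1)) \<le> card ?T"
      using fin(1) by (intro diff_card_le_card_Diff) simp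
    moreover have "card (g2 ` ?S2) \<le> card ?S2" using fin(2) by (rule card_image_le)
    ultimately have "card (g2 ` ?S2) \<le> card ?T" using S12 by simp
    then obtain j where j: "inj_on j (g2 ` ?S2)" "j ` g2 ` ?S2 \<subseteq> ?T"
      using card_le_inj[of "g2 ` ?S2" ?T] fin(2) by auto
    \<comment> \<open>The prescribed part of the permutation: the colour of \<open>v\<close> is
      matched with \<open>f1 v\<close>, those on \<open>?S2\<close> go into \<open>?T\<close>. The
      two do not collide because \<open>?T\<close> omits \<open>f1 v\<close>.\<close>
    define h where "h c = (if c = f2 v then f1 v else j c)" for c
    have f2v: "f2 v \<notin> g2 ` ?S2" using c2(3) by blast
    then have hj: "h (g2 e) = j (g2 e)" if "e \<in> ?S2" for e
      using imageI[OF that, of g2] unfolding h_def by auto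
    have inj_h: "inj_on h (insert (f2 v) (g2 ` ?S2))"
    proof (rule inj_onI)
      fix x y assume "x \<in> insert (f2 v) (g2 ` ?S2)" "y \<in> insert (f2 v) (g2 ` ?S2)" "h x = h y"
      then show "x = y"
        using j f2v unfolding h_def by (auto split: if_splits dest: inj_onD)
    qed
    have "insert (f2 v) (g2 ` ?S2) \<subseteq> {..<k}" using b2 vC2 by auto
    moreover have "h ` insert (f2 v) (g2 ` ?S2) \<subseteq> {..<k}"
      using j(2) b1(1)[of v] unfolding h_def by auto
    ultimately obtain \<pi> where \<pi>: "bij_betw \<pi> {..<k} {..<k}"
      and \<pi>h: "\<And>a. a \<in> insert (f2 v) (g2 ` ?S2) \<Longrightarrow> \<pi> a = h a"
      using ex_bij_betw_extending[of "{..<k}" _ h] inj_h by blast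
    have inj: "\<pi> x \<noteq> \<pi> y" if "x < k" "y < k" "x \<noteq> y" for x y
      using \<pi> that unfolding bij_betw_def inj_on_def by blast
    have \<pi>k: "\<pi> x < k" if "x < k" for x using \<pi> that unfolding bij_betw_def by blast
    have \<pi>v: "\<pi> (f2 v) = f1 v" using \<pi>h by (simp add: h_def)
    have \<pi>S: "\<pi> (g2 e) \<notin> g1 ` ?S1" if "e \<in> ?S2" for e
    proof -
      have "g2 e \<in> g2 ` ?S2" using that by (rule imageI)
      then have "\<pi> (g2 e) = j (g2 e)" "j (g2 e) \<in> ?T" using \<pi>h[of "g2 e"] hj[OF that] j(2) by auto
      then show ?thesis by simp
    qed
    define f where "f w = (if w \<in> C then f1 w else \<pi> (f2 w))" for w
    define g where "g e = (if e \<subseteq> ?C1 then g1 e else \<pi> (g2 e))" for e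
    have f1: "f w = f1 w" if "w \<in> ?C1" for w using that \<pi>v C(1) by (auto simp: f_def)
    have f2: "f w = \<pi> (f2 w)" if "w \<in> ?C2" for w using that by (simp add: f_def)
    have g1: "g e = g1 e" if "e \<subseteq> ?C1" for e using that by (simp add: g_def)
    have g2: "g e = \<pi> (g2 e)" if "e \<in> edges G" "e \<subseteq> ?C2" for e
      using that disj by (auto simp: g_def)
    have mixed: "g d \<noteq> g e" if "d \<in> ?E1" "e \<in> ?E2" "d \<inter> e \<noteq> {}" for d e
    proof -
      have "v \<in> d" "v \<in> e" using that by blast+
      then have "d \<in> ?S1" "e \<in> ?S2" using that by simp_all
      then show ?thesis using \<pi>S[of e] g1[of d] g2[of e] that by (metis (no_types, lifting) image_eqI mem_Collect_eq)
    qed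
    have "total_colorable G k"
    proof (rule total_colorableI)
      show "total_col G f g"
      proof (rule total_colI)
        fix u w assume e: "{u, w} \<in> edges G"
        show "f u \<noteq> f w"
          using cover[OF e]
        proof
          assume "{u, w} \<subseteq> ?C1"
          then show ?thesis using c1(1)[of u w] e f1 by simp
        next
          assume "{u, w} \<subseteq> ?C2"
          then show ?thesis using c2(1)[of u w] e f2 inj b2(1) by simp
        qed
      next
        fix d e assume de: "d \<in> edges G" "e \<in> edges G" "d \<noteq> e" "d \<inter> e \<noteq> {}"
        then consider "d \<in> ?E1" "e \<in> ?E1" | "d \<in> ?E2" "e \<in> ?E2" | "d \<in> ?E1" "e \<in> ?E2" | "d \<in> ?E2" "e \<in> ?E1"
          using cover by blast
        then show "g d \<noteq> g e"
        proof cases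
          case 1
          then show ?thesis using c1(2)[OF 1 de(3,4)] g1 by simp
        next
          case 2
          then show ?thesis using c2(2)[OF 2 de(3,4)] g2 inj b2(2) by simp
        next
          case 3
          then show ?thesis using mixed de by blast
        next
          case 4
          then show ?thesis using mixed[of e d] de(4) by (metis inf_commute)
        qed
      next
        fix e w assume e: "e \<in> edges G" "w \<in> e"
        show "f w \<noteq> g e"
          using cover[OF e(1)]
        proof
          assume "e \<subseteq> ?C1"
          then show ?thesis using c1(3)[of e w] e f1[of w] g1[of e] by auto
        next
          assume "e \<subseteq> ?C2"
          moreover from this have "w \<in> ?C2" using e(2) by blast
          ultimately show ?thesis
            using c2(3)[of e w] e f2[of w] g2[of e] inj b2(1)[of w] b2(2)[of e] by simp
        qed
      qed
      show "f w < k" if "w \<in> verts G" for w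
        using that b1(1) b2(1) \<pi>k unfolding f_def by auto
      show "g e < k" if "e \<in> edges G" for e
        using cover[OF that] b1(2)[OF that] b2(2)[OF that] \<pi>k unfolding g_def by presburger
    qed
    then show False using not_colorable by blast
  qed
qed

text \<open>Colour \<open>G - xy\<close>, forget the colour of \<open>x\<close>, and colour first \<open>xy\<close> and then \<open>x\<close> greedily.\<close>

lemma degree_sum:
  assumes xy: "{x, y} \<in> edges G" and x: "2 * degree G x < k"
  shows "k < degree G x + degree G y"
proof (rule ccontr)
  assume sum: "\<not> ?thesis"
  let ?e = "{x, y}" and ?E = "edges G - {{x, y}}"
  let ?H = "Graph (verts G) ?E"
  have "x \<noteq> y" using simple_graph_edge[OF simple xy] by blast
  have "subgraph ?H G" using simple unfolding subgraph_def simple_graph_def by auto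
  moreover have "?H \<noteq> G" using xy by (metis Diff_iff graph.sel(2) insertI1)
  ultimately have "total_colorable ?H k" by (rule critical)
  then obtain f g where fg: "total_col ?H f g" and b: "\<forall>v\<in>verts ?H. f v < k" "\<forall>e\<in>edges ?H. g e < k"
    by (rule total_colorableE)
  note fg = total_colD[OF fg, unfolded graph.sel]
  let ?S = "\<lambda>v. {e \<in> edges G. v \<in> e} - {?e}"
  have S: "finite (?S v)" "card (g ` ?S v) \<le> degree G v - 1" if "v \<in> ?e" for v
  proof -
    have "card (?S v) = degree G v - 1"
      unfolding degree_def using that xy finite_edges_at[of v] by (subst card_Diff_singleton) auto
    then show "finite (?S v)" "card (g ` ?S v) \<le> degree G v - 1"
      using finite_edges_at[of v] card_image_le[of "?S v" g] by auto
  qed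
  have pos: "degree G v > 0" if "v \<in> ?e" for v
    unfolding degree_def using that xy finite_edges_at[of v] by (auto simp: card_gt_0_iff)
  \<comment> \<open>The colours forbidden for \<open>xy\<close>: that of \<open>y\<close> and those
    of the \<open>degree G x - 1\<close> and \<open>degree G y - 1\<close> other edges at its ends,
    at most \<open>k - 1\<close> by the negated claim. The colour of \<open>x\<close> does not
    count, since \<open>x\<close> is recoloured afterwards.\<close>
  have "card (insert (f y) (g ` ?S x \<union> g ` ?S y)) \<le> Suc (card (g ` ?S x) + card (g ` ?S y))"
    using card_Un_le[of "g ` ?S x" "g ` ?S y"] S(1) by (auto simp: card_insert_if)
  also have "\<dots> < k" using S(2)[of x] S(2)[of y] pos[of x] pos[of y] sum by simp
  finally have card: "card (insert (f y) (g ` ?S x \<union> g ` ?S y)) < k" .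
  have "finite (insert (f y) (g ` ?S x \<union> g ` ?S y))" using S(1) by simp
  then obtain \<gamma> where "\<gamma> < k" "\<gamma> \<notin> insert (f y) (g ` ?S x \<union> g ` ?S y)"
    using card by (rule ex_colour_notin)
  then have \<gamma>: "\<gamma> < k" "\<gamma> \<noteq> f y" "\<gamma> \<notin> g ` ?S x" "\<gamma> \<notin> g ` ?S y" by blast+
  define g' where "g' = g(?e := \<gamma>)"
  let ?N = "{u. {x, u} \<in> edges G}" and ?X = "{e \<in> edges G. x \<in> e}"
  have "card (f ` ?N \<union> g' ` ?X) \<le> card (f ` ?N) + card (g' ` ?X)" by (rule card_Un_le)
  also have "\<dots> \<le> 2 * degree G x"
    using card_image_le[OF finite_neighbours[OF simple], of f x] card_neighbours[OF simple, of x]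
      card_image_le[OF finite_edges_at, of g' x] by (simp add: degree_def)
  also have "\<dots> < k" by (rule x)
  finally have card: "card (f ` ?N \<union> g' ` ?X) < k" .
  have "finite (f ` ?N \<union> g' ` ?X)" using finite_neighbours[OF simple] finite_edges_at by simp
  then obtain \<delta> where "\<delta> < k" "\<delta> \<notin> f ` ?N \<union> g' ` ?X"
    using card by (rule ex_colour_notin)
  then have \<delta>: "\<delta> < k" "\<delta> \<notin> f ` ?N" "\<delta> \<notin> g' ` ?X" by blast+
  define f' where "f' = f(x := \<delta>)"
  have gnew: "g h \<noteq> \<gamma>" if "h \<in> ?E" "?e \<inter> h \<noteq> {}" for h
    using that \<gamma>(3,4) by auto
  have "total_colorable G k"
  proof (rule total_colorableI)
    show "total_col G f' g'"
    proof (rule total_colI)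
      fix u v assume uv: "{u, v} \<in> edges G"
      then have "u \<noteq> v" "{v, u} \<in> edges G"
        using simple_graph_edge[OF simple uv] by (auto simp: insert_commute)
      then show "f' u \<noteq> f' v"
        using \<delta>(2) fg(1)[of u v] uv unfolding f'_def by (auto simp: doubleton_eq_iff)
    next
      fix d e assume de: "d \<in> edges G" "e \<in> edges G" "d \<noteq> e" "d \<inter> e \<noteq> {}"
      then show "g' d \<noteq> g' e"
        using gnew[of d] gnew[of e] fg(2)[of d e] unfolding g'_def by (auto simp: Int_commute)
    next
      fix e v assume e: "e \<in> edges G" "v \<in> e"
      show "f' v \<noteq> g' e"
      proof (cases "v = x")
        case True
        then show ?thesis using \<delta>(3) e unfolding f'_def by auto
      next
        case False
        then show ?thesis using e fg(3)[of e v] \<gamma>(2) unfolding f'_def g'_def by auto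
      qed
    qed
  qed (use b \<delta>(1) \<gamma>(1) in \<open>auto simp: f'_def g'_def\<close>)
  then show False using not_colorable by blast
qed

lemma other_edge_unique:
  assumes deg: "degree G v \<le> 2" and "d \<in> edges G" "v \<in> d" "e \<in> edges G" "v \<in> e" "e' \<in> edges G" "v \<in> e'"
    and "e \<noteq> d" "e' \<noteq> d"
  shows "e = e'"
proof (rule ccontr)
  assume "e \<noteq> e'"
  then have "card {d, e, e'} = 3" using assms by auto
  moreover have "card {d, e, e'} \<le> degree G v"
    unfolding degree_def using assms by (intro card_mono finite_edges_at) auto
  ultimately show False using deg by simp
qed

text \<open>By connectivity, a nonempty \<open>S\<close> has a vertex \<open>s\<close> with a
  neighbour outside, hence with at most one edge inside \<open>S\<close>. Coloured last,
  \<open>s\<close> has to respect one neighbour and its edge at most one other edge. Separate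
  palettes for vertices and edges settle all incidences.\<close>

lemma ex_bicoloring_induced:
  assumes deg: "\<And>v. v \<in> verts G \<Longrightarrow> degree G v \<le> 2" and conn: "conn G (verts G)"
    and S: "S \<subseteq> verts G" "S \<noteq> verts G"
  shows "\<exists>f g. total_col (Graph S {e \<in> edges G. e \<subseteq> S}) f g \<and>
    (\<forall>v. f v \<in> {0, 1}) \<and> (\<forall>e. g e \<in> {2, 3})"
  using S
proof (induction "card S" arbitrary: S rule: less_induct)
  case less
  show ?case
  proof (cases "S = {}")
    case True
    have no: "\<not> e \<subseteq> {}" if "e \<in> edges G" for e using edge_not_subset_singleton[OF that] by blast
    have "total_col (Graph S {e \<in> edges G. e \<subseteq> S}) (\<lambda>_. 0) (\<lambda>_. 2)"
      unfolding True by (rule total_colI) (use no in auto)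
    then show ?thesis by (intro exI[of _ "\<lambda>_. 0"] exI[of _ "\<lambda>_. 2"]) simp
  next
    case False
    obtain s b where s: "s \<in> S" "b \<in> verts G" "b \<notin> S" "{s, b} \<in> edges G"
      using connE[OF conn less.prems(1) False less.prems(2)] by metis
    have sV: "s \<in> verts G" using s(1) less.prems(1) by blast
    have unique: "e = e'" if "e \<in> edges G" "e \<subseteq> S" "s \<in> e" "e' \<in> edges G" "e' \<subseteq> S" "s \<in> e'" for e e'
      using other_edge_unique[OF deg[OF sV] s(4)] that s(3) by blast
    have "card (S - {s}) < card S"
      using s(1) less.prems(1) finite_verts finite_subset by (intro psubset_card_mono) auto
    then obtain f g where fg: "total_col (Graph (S - {s}) {e \<in> edges G. e \<subseteq> S - {s}}) f g"
      and f: "\<And>v. f v \<in> {0, 1}" and g: "\<And>e. g e \<in> {2, 3}"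
      using less.hyps[of "S - {s}"] less.prems s(1) by blast
    note fg = total_colD[OF fg, unfolded graph.sel]
    show ?thesis
    proof (cases "\<exists>e\<in>edges G. e \<subseteq> S \<and> s \<in> e")
      case False
      then have "{e \<in> edges G. e \<subseteq> S} = {e \<in> edges G. e \<subseteq> S - {s}}" by blast
      then have "total_col (Graph S {e \<in> edges G. e \<subseteq> S}) f g"
        by (intro total_colI) (simp_all add: fg)
      then show ?thesis using f g by blast
    next
      case True
      then obtain e where e: "e \<in> edges G" "e \<subseteq> S" "s \<in> e" by blast
      then obtain p where p: "e = {s, p}" "p \<noteq> s" "p \<in> verts G" using edgeE by metis
      have split: "d = e \<or> d \<subseteq> S - {s}" if "d \<in> edges G" "d \<subseteq> S" for d
        using unique[OF e that] that by blast
      have "\<exists>c\<in>{2, 3}. \<forall>d\<in>edges G. d \<subseteq> S - {s} \<longrightarrow> p \<in> d \<longrightarrow> g d \<noteq> c"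
      proof (cases "\<exists>d\<in>edges G. d \<subseteq> S - {s} \<and> p \<in> d")
        case True
        then obtain d where d: "d \<in> edges G" "d \<subseteq> S - {s}" "p \<in> d" by blast
        have "d' = d" if "d' \<in> edges G" "d' \<subseteq> S - {s}" "p \<in> d'" for d'
          using other_edge_unique[OF deg[OF p(3)] e(1), of d' d] that d p(1) e(3) by blast
        \<comment> \<open>\<open>5 - g d\<close> is the other one of the colours 2 and 3; likewise
          \<open>1 - f p\<close> below exchanges 0 and 1.\<close>
        then show ?thesis using g[of d] by (intro bexI[of _ "5 - g d"]) auto
      qed auto
      then obtain c where c: "c \<in> {2, 3}" "\<And>d. d \<in> edges G \<Longrightarrow> d \<subseteq> S - {s} \<Longrightarrow> p \<in> d \<Longrightarrow> g d \<noteq> c"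
        by blast
      define f' where "f' = f(s := 1 - f p)"
      define g' where "g' = g(e := c)"
      have f': "f' v \<in> {0, 1}" for v using f[of v] unfolding f'_def by auto
      have g': "g' d \<in> {2, 3}" for d using g[of d] c(1) unfolding g'_def by auto
      have gnew: "g d \<noteq> c" if "d \<in> edges G" "d \<subseteq> S - {s}" "d \<inter> e \<noteq> {}" for d
        using c(2)[of d] that p(1) by blast
      have "total_col (Graph S {e \<in> edges G. e \<subseteq> S}) f' g'"
      proof (rule total_colI, unfold graph.sel)
        fix u v assume uv: "{u, v} \<in> {e \<in> edges G. e \<subseteq> S}"
        then have "{u, v} = e \<or> {u, v} \<subseteq> S - {s}" using split by blast
        then show "f' u \<noteq> f' v"
        proof
          assume "{u, v} = e"
          then show ?thesis using p f[of p] by (auto simp: f'_def doubleton_eq_iff)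
        next
          assume "{u, v} \<subseteq> S - {s}"
          then show ?thesis using fg(1)[of u v] uv by (simp add: f'_def)
        qed
      next
        fix d d' assume d: "d \<in> {e \<in> edges G. e \<subseteq> S}" "d' \<in> {e \<in> edges G. e \<subseteq> S}" "d \<noteq> d'" "d \<inter> d' \<noteq> {}"
        then show "g' d \<noteq> g' d'"
          using split[of d] split[of d'] gnew[of d] gnew[of d'] fg(2)[of d d']
          unfolding g'_def by (auto simp: Int_commute)
      next
        fix d v
        show "f' v \<noteq> g' d" using f'[of v] g'[of d] by auto
      qed
      then show ?thesis using f' g' by blast
    qed
  qed
qed

text \<open>After bicolouring \<open>G - v\<close>, the vertex \<open>v\<close> takes the colour of the further edge at \<open>q\<close>.\<close>

lemma max_degree_ne_two:
  assumes deg: "\<And>v. v \<in> verts G \<Longrightarrow> degree G v \<le> 2" and conn: "conn G (verts G)" and k: "4 \<le> k"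
    and v: "v \<in> verts G"
  shows "degree G v \<noteq> 2"
proof
  assume dv: "degree G v = 2"
  obtain p where p: "{v, p} \<in> edges G" using ex_neighbour_notin[OF simple, of "{}" v] dv by auto
  obtain q where q: "{v, q} \<in> edges G" "q \<noteq> p" using ex_neighbour_notin[OF simple, of "{p}" v] dv by auto
  have pq: "p \<in> verts G" "p \<noteq> v" "q \<in> verts G" "q \<noteq> v"
    using simple_graph_edge[OF simple p] simple_graph_edge[OF simple q(1)] by auto
  define S where "S = verts G - {v}"
  obtain f g where fg: "total_col (Graph S {e \<in> edges G. e \<subseteq> S}) f g"
    and f: "\<And>v. f v \<in> {0, 1}" and g: "\<And>e. g e \<in> {2, 3}"
    using ex_bicoloring_induced[OF deg conn, of S] v unfolding S_def by blast
  note fg = total_colD[OF fg, unfolded graph.sel]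
  have split: "e = {v, p} \<or> e = {v, q} \<or> e \<subseteq> S" if e: "e \<in> edges G" for e
  proof (cases "v \<in> e")
    case True
    have "{v, q} \<noteq> {v, p}" using q(2) by (auto simp: doubleton_eq_iff)
    then show ?thesis
      using other_edge_unique[OF deg[OF v] p _ q(1) _ e True] by blast
  next
    case False
    then show ?thesis using e simple unfolding S_def simple_graph_def by blast
  qed
  have "\<exists>a\<in>{2, 3}. \<forall>e\<in>edges G. e \<subseteq> S \<longrightarrow> q \<in> e \<longrightarrow> g e = a"
  proof (cases "\<exists>e\<in>edges G. e \<subseteq> S \<and> q \<in> e")
    case True
    then obtain e where e: "e \<in> edges G" "e \<subseteq> S" "q \<in> e" by blast
    have "e' = e" if "e' \<in> edges G" "e' \<subseteq> S" "q \<in> e'" for e'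
      using other_edge_unique[OF deg[OF pq(3)] q(1), of e' e] that e unfolding S_def by blast
    then show ?thesis using g[of e] by (intro bexI[of _ "g e"]) auto
  qed auto
  then obtain a where a: "a \<in> {2, 3}" "\<And>e. e \<in> edges G \<Longrightarrow> e \<subseteq> S \<Longrightarrow> q \<in> e \<Longrightarrow> g e = a"
    by blast
  \<comment> \<open>\<open>v\<close> and \<open>vp\<close> trade palettes: \<open>v\<close> takes
    the edge colour \<open>a\<close>, \<open>vp\<close> the vertex colour that \<open>p\<close> does
    not have, and \<open>vq\<close> the other edge colour. Keeping the palettes apart all around a
    cycle would require even length.\<close>
  define f' where "f' = f(v := a)"
  define g' where "g' = g({v, q} := 5 - a, {v, p} := 1 - f p)"
  have g'p: "g' {v, p} = 1 - f p" by (simp add: g'_def)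
  have g'q: "g' {v, q} = 5 - a" using q(2) by (auto simp: g'_def doubleton_eq_iff)
  have vS: "v \<notin> S" by (simp add: S_def)
  have g'S: "g' e = g e" if "e \<subseteq> S" for e using that vS by (auto simp: g'_def)
  have edge_ne: "g' d \<noteq> g' e"
    if d: "d = {v, p} \<or> d = {v, q}" and e: "e \<in> edges G" "d \<noteq> e" "d \<inter> e \<noteq> {}" for d e
  proof (cases "e \<subseteq> S")
    case True
    then have "d = {v, q} \<Longrightarrow> g e = a" using a(2)[OF e(1)] e(3) vS by blast
    then show ?thesis using d g'p g'q g'S[OF True] a(1) g[of e] f[of p] by auto
  next
    case False
    then show ?thesis using split[OF e(1)] d e(2) g'p g'q a(1) f[of p] by auto
  qed
  have "total_colorable G k"
  proof (rule total_colorableI)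
    show "total_col G f' g'"
    proof (rule total_colI)
      fix u w assume uw: "{u, w} \<in> edges G"
      show "f' u \<noteq> f' w"
      proof (cases "{u, w} \<subseteq> S")
        case True
        then show ?thesis using fg(1)[of u w] uw vS by (auto simp: f'_def)
      next
        case False
        then show ?thesis using split[OF uw] pq a(1) f[of p] f[of q] by (auto simp: f'_def doubleton_eq_iff)
      qed
    next
      fix d e assume de: "d \<in> edges G" "e \<in> edges G" "d \<noteq> e" "d \<inter> e \<noteq> {}"
      show "g' d \<noteq> g' e"
      proof (cases "d \<subseteq> S \<and> e \<subseteq> S")
        case True
        then show ?thesis using fg(2)[of d e] de g'S by simp
      next
        case False
        then have "(d = {v, p} \<or> d = {v, q}) \<or> (e = {v, p} \<or> e = {v, q})"
          using split[OF de(1)] split[OF de(2)] by argo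
        then show ?thesis using edge_ne[of d e] edge_ne[of e d] de by (metis Int_commute)
      qed
    next
      fix e w assume e: "e \<in> edges G" "w \<in> e"
      then consider "e = {v, p}" | "e = {v, q}" | "e \<subseteq> S" using split by blast
      then show "f' w \<noteq> g' e"
      proof cases
        case 1
        then show ?thesis using e(2) g'p pq a(1) f[of p] by (auto simp: f'_def)
      next
        case 2
        then show ?thesis using e(2) g'q pq a(1) f[of q] by (auto simp: f'_def)
      next
        case 3
        then have "w \<noteq> v" using e(2) vS by blast
        then show ?thesis using fg(3)[of e w] e 3 g'S by (simp add: f'_def)
      qed
    qed
    show "f' w < k" for w using f[of w] a(1) k by (auto simp: f'_def)
    show "g' e < k" for e
      using f[of p] g[of e] a(1) k by (auto simp: g'_def)
  qed
  then show False using not_colorable by blast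
qed

end

section \<open>Minors of total graphs\<close>

lemma minor_model_insert:
  assumes m: "minor_model G \<B>" and B: "B \<subseteq> verts G" "conn G B"
    and disj: "\<And>C. C \<in> \<B> \<Longrightarrow> B \<inter> C = {}"
    and adj: "\<And>C. C \<in> \<B> \<Longrightarrow> \<exists>b\<in>B. \<exists>c\<in>C. {b, c} \<in> edges G"
  shows "minor_model G (insert B \<B>)"
  unfolding minor_model_def
proof (intro conjI ballI impI)
  fix C assume "C \<in> insert B \<B>"
  then show "C \<subseteq> verts G" "conn G C" using B minor_modelD(1,2)[OF m] by auto
next
  fix C D assume CD: "C \<in> insert B \<B>" "D \<in> insert B \<B>" "C \<noteq> D"
  then consider "C = B" "D \<in> \<B>" | "D = B" "C \<in> \<B>" | "C \<in> \<B>" "D \<in> \<B>" by blast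
  then have "C \<inter> D = {} \<and> (\<exists>b\<in>C. \<exists>c\<in>D. {b, c} \<in> edges G)"
  proof cases
    case 1
    then show ?thesis using disj adj by simp
  next
    case 2
    then obtain b c where "b \<in> B" "c \<in> C" "{b, c} \<in> edges G" using adj by blast
    then have "\<exists>b\<in>C. \<exists>c\<in>D. {b, c} \<in> edges G"
      using 2(1) by (intro bexI[of _ c] bexI[of _ b]) (auto simp: insert_commute)
    then show ?thesis using 2 disj[of C] by (simp add: Int_commute)
  next
    case 3
    then show ?thesis using minor_modelD(3,4)[OF m] CD(3) by simp
  qed
  then show "C \<inter> D = {}" "\<exists>b\<in>C. \<exists>c\<in>D. {b, c} \<in> edges G" by simp_all
qed

definition star_model :: "'a graph \<Rightarrow> 'a \<Rightarrow> ('a + 'a set) set set" where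
  "star_model G v = insert {Inl v} ((\<lambda>e. {Inr e}) ` {e \<in> edges G. v \<in> e})"

lemma card_star_model:
  assumes "simple_graph G"
  shows "card (star_model G v) = Suc (degree G v)"
proof -
  have "inj_on (\<lambda>e. {Inr e}) {e \<in> edges G. v \<in> e}" by (simp add: inj_on_def)
  then have "card ((\<lambda>e. {Inr e} :: ('a + 'a set) set) ` {e \<in> edges G. v \<in> e}) = degree G v"
    unfolding degree_def by (rule card_image)
  moreover have "{Inl v} \<notin> (\<lambda>e. {Inr e}) ` {e \<in> edges G. v \<in> e}" by auto
  moreover have "finite {e \<in> edges G. v \<in> e}" using simple_graph_finite_edges[OF assms] by simp
  ultimately show ?thesis unfolding star_model_def by simp
qed

lemma finite_star_model:
  assumes "simple_graph G"
  shows "finite (star_model G v)"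
  unfolding star_model_def using simple_graph_finite_edges[OF assms] by simp

lemma minor_model_star_model:
  assumes v: "v \<in> verts G"
  shows "minor_model (total_graph G) (star_model G v)"
  unfolding minor_model_def
proof (intro conjI ballI impI)
  fix B assume B: "B \<in> star_model G v"
  then show "B \<subseteq> verts (total_graph G)" using v by (auto simp: star_model_def total_graph_def)
  show "conn (total_graph G) B" using B by (auto simp: star_model_def conn_singleton)
next
  fix B C assume BC: "B \<in> star_model G v" "C \<in> star_model G v" "B \<noteq> C"
  then obtain b c where bc: "B = {b}" "C = {c}" unfolding star_model_def by blast
  then show "B \<inter> C = {}" using BC(3) by auto
  have "{b, c} \<in> edges (total_graph G)"
    using BC bc unfolding star_model_def by (auto intro!: total_graph_edgeI)
  then show "\<exists>b\<in>B. \<exists>c\<in>C. {b, c} \<in> edges (total_graph G)" using bc by simp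
qed

lemma conn_Inl: "conn G S \<Longrightarrow> conn (total_graph G) (Inl ` S)"
  by (erule conn_image) (rule total_graph_edgeI)

section \<open>Additional branch sets in critical graphs\<close>

context total_critical
begin

text \<open>Every edge at \<open>v\<close> has its other end in \<open>verts G - {v}\<close>, and
  such an end is a neighbour of \<open>v\<close>, so this set is adjacent to the whole star. The
  bound \<open>degree G v < k\<close> is what makes it connected.\<close>

lemma minor_plus_two:
  assumes v: "v \<in> verts G" and deg: "0 < degree G v" "degree G v < k"
  shows "\<exists>\<B>. finite \<B> \<and> minor_model (total_graph G) \<B> \<and> card \<B> = degree G v + 2"
proof -
  obtain x where x: "{v, x} \<in> edges G" using ex_neighbour_notin[OF simple, of "{}" v] deg by auto
  have "verts G \<noteq> {v}" using simple_graph_edge[OF simple x] by auto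
  then have conn: "conn G (verts G - {v})" using conn_delete_vertex[OF v deg(2)] by blast
  let ?B = "Inl ` (verts G - {v}) :: ('a + 'a set) set"
  have disj: "?B \<inter> C = {}" if "C \<in> star_model G v" for C
    using that by (auto simp: star_model_def)
  have "minor_model (total_graph G) (insert ?B (star_model G v))"
  proof (rule minor_model_insert[OF minor_model_star_model[OF v] _ _ disj])
    show "?B \<subseteq> verts (total_graph G)" by (auto simp: total_graph_def)
    show "conn (total_graph G) ?B" by (rule conn_Inl[OF conn])
    fix C assume "C \<in> star_model G v"
    then consider "C = {Inl v}" | e where "C = {Inr e}" "e \<in> edges G" "v \<in> e"
      unfolding star_model_def by blast
    then show "\<exists>b\<in>?B. \<exists>c\<in>C. {b, c} \<in> edges (total_graph G)"
    proof cases
      case 1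
      have "x \<in> verts G - {v}" using simple_graph_edge[OF simple x] by blast
      moreover have "{Inl x, Inl v} \<in> edges (total_graph G)"
        using x by (intro total_graph_edgeI) (simp add: insert_commute)
      ultimately show ?thesis unfolding 1 by (intro bexI[of _ "Inl x"] bexI[of _ "Inl v"]) auto
    next
      case 2
      obtain u where u: "e = {v, u}" "u \<noteq> v" "u \<in> verts G" using 2(2,3) by (rule edgeE)
      have "{Inl u, Inr e} \<in> edges (total_graph G)"
        using 2(2) u(1) by (intro total_graph_edgeI) auto
      then show ?thesis unfolding 2(1) using u by (intro bexI[of _ "Inl u"] bexI[of _ "Inr e"]) auto
    qed
  qed
  moreover have "?B \<notin> star_model G v" using disj[of ?B] conn_nonempty[OF conn] by blast
  then have "card (insert ?B (star_model G v)) = degree G v + 2"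
    using finite_star_model[OF simple] card_star_model[OF simple] by simp
  moreover have "finite (insert ?B (star_model G v))" using finite_star_model[OF simple] by simp
  ultimately show ?thesis by blast
qed

text \<open>Two vertices cannot block all edges at a vertex of degree at least 3. Below they are
  \<open>v\<close> and \<open>u\<close>, and the edge then lies inside \<open>W\<close>.\<close>

lemma ex_edge_avoiding:
  assumes "2 < degree G s" "s \<noteq> a" "s \<noteq> b"
  obtains e where "e \<in> edges G" "s \<in> e" "e \<subseteq> verts G - {a, b}"
proof -
  have "card {a, b} < degree G s" using assms(1) by (auto simp: card_insert_if)
  then obtain x where x: "{s, x} \<in> edges G" "x \<notin> {a, b}"
    using ex_neighbour_notin[OF simple, of "{a, b}"] by blast
  then have "{s, x} \<subseteq> verts G - {a, b}" using simple_graph_edge[OF simple x(1)] assms(2,3) by blast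
  then show ?thesis using that x(1) by blast
qed

text \<open>An edge \<open>vs\<close> with \<open>s\<close> in \<open>W\<close> touches
  \<open>A\<close> in \<open>s\<close> and \<open>B\<close> in an edge at \<open>s\<close> inside
  \<open>W\<close>. The edge \<open>vu\<close> touches \<open>A\<close> in \<open>uw\<close> and
  \<open>B\<close> in \<open>u\<close>; \<open>v\<close> itself touches \<open>A\<close> in another
  neighbour and \<open>B\<close> in \<open>u\<close>. Finally \<open>uw\<close> in \<open>A\<close>
  is adjacent to \<open>u\<close> in \<open>B\<close>, and \<open>w'\<close> differs from
  \<open>w\<close> to keep the two sets disjoint.\<close>

lemma minor_plus_three:
  assumes v: "v \<in> verts G" and deg: "2 < degree G v"
    and two: "\<And>x. x \<in> verts G \<Longrightarrow> conn G (verts G - {x})"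
    and three: "\<And>x y. {x, y} \<in> edges G \<Longrightarrow> 2 < degree G x"
  shows "\<exists>\<B>. finite \<B> \<and> minor_model (total_graph G) \<B> \<and> card \<B> = degree G v + 3"
proof -
  let ?T = "total_graph G"
  obtain x0 where x0: "{v, x0} \<in> edges G" using ex_neighbour_notin[OF simple, of "{}" v] deg by auto
  have "verts G \<noteq> {v, x}" for x
  proof
    assume V: "verts G = {v, x}"
    obtain y where "{v, y} \<in> edges G" "y \<notin> {x}" using ex_neighbour_notin[OF simple, of "{x}" v] deg by auto
    then show False using simple_graph_edge[OF simple, of v y] V by auto
  qed
  then obtain u where u: "u \<in> verts G" "u \<noteq> v" "{v, u} \<in> edges G" and conn: "conn G (verts G - {v, u})"
    using ex_neighbour_non_cut[OF finite_verts v two, of x0] simple_graph_edge[OF simple x0] x0 by blast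
  define W where "W = verts G - {v, u}"
  have uv: "{u, v} \<in> edges G" using u(3) by (simp add: insert_commute)
  have deg_u: "2 < degree G u" using uv by (rule three)
  obtain w where w: "{u, w} \<in> edges G" "w \<notin> {v}"
    using ex_neighbour_notin[OF simple, of "{v}" u] deg_u by auto
  have "card {v, w} < degree G u" using deg_u by (auto simp: card_insert_if)
  then obtain w' where w': "{u, w'} \<in> edges G" "w' \<notin> {v, w}"
    using ex_neighbour_notin[OF simple, of "{v, w}" u] by blast
  have W: "w \<in> W" "w' \<in> W"
    using w w' simple_graph_edge[OF simple w(1)] simple_graph_edge[OF simple w'(1)]
    unfolding W_def by blast+
  have in_W: "\<exists>e\<in>edges G. s \<in> e \<and> e \<subseteq> W" if s: "s \<in> W" "{s, y} \<in> edges G" for s y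
    using ex_edge_avoiding[OF three[OF s(2)], of v u] s(1) unfolding W_def by blast
  let ?E = "{e \<in> edges G. e \<subseteq> W}"
  define A :: "('a + 'a set) set" where "A = insert (Inr {u, w}) (Inl ` W)"
  define B :: "('a + 'a set) set" where "B = insert (Inl u) (insert (Inr {u, w'}) (Inr ` ?E))"
  have "{w', u} \<in> edges G" using w'(1) by (simp add: insert_commute)
  then obtain e' where e': "e' \<in> edges G" "w' \<in> e'" "e' \<subseteq> W" using in_W[OF W(2)] by blast
  have connA: "conn ?T A"
    unfolding A_def
  proof (rule conn_insert)
    show "conn ?T (Inl ` W)" unfolding W_def by (rule conn_Inl[OF conn])
    show "Inl w \<in> Inl ` W" using W(1) by simp
    show "{Inr {u, w}, Inl w} \<in> edges ?T" using w(1) by (intro total_graph_edgeI) auto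
  qed
  have uW: "u \<notin> W" "v \<notin> W" by (auto simp: W_def)
  have connB: "conn ?T B"
    unfolding B_def
  proof (rule conn_insert)
    show "conn ?T (insert (Inr {u, w'}) (Inr ` ?E))"
    proof (rule conn_insert)
      show "conn ?T (Inr ` ?E)"
        using conn e'(1,3) unfolding W_def by (rule conn_line_graph[OF simple])
      show "Inr e' \<in> Inr ` ?E" using e' by simp
      show "{Inr {u, w'}, Inr e'} \<in> edges ?T"
        using w'(1) e' uW by (intro total_graph_edgeI) auto
    qed
    show "Inr {u, w'} \<in> insert (Inr {u, w'}) (Inr ` ?E)" by simp
    show "{Inl u, Inr {u, w'}} \<in> edges ?T" using w'(1) by (intro total_graph_edgeI) auto
  qed
  have sub: "A \<subseteq> verts ?T" "B \<subseteq> verts ?T"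
    using w(1) w'(1) u(1) by (auto simp: A_def B_def W_def total_graph_def)
  have ww': "{u, w} \<noteq> {u, w'}" using w'(2) by (auto simp: doubleton_eq_iff)
  have AB: "A \<inter> B = {}" using ww' uW by (auto simp: A_def B_def)
  have vne: "v \<notin> {u, w}" "v \<notin> {u, w'}" using u(2) w(2) w'(2) by auto
  have starE: "thesis" if "C \<in> star_model G v" "C = {Inl v} \<Longrightarrow> thesis"
    "\<And>s. C = {Inr {v, s}} \<Longrightarrow> {v, s} \<in> edges G \<Longrightarrow> s \<noteq> v \<Longrightarrow> s \<in> verts G \<Longrightarrow> thesis" for C thesis
  proof -
    from that(1) consider "C = {Inl v}" | e where "C = {Inr e}" "e \<in> edges G" "v \<in> e"
      unfolding star_model_def by blast
    then show thesis
    proof cases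
      case 2
      obtain s where "e = {v, s}" "s \<noteq> v" "s \<in> verts G" using 2(2,3) by (rule edgeE)
      then show thesis using 2 that(3) by simp
    qed (rule that(2))
  qed
  have disjA: "A \<inter> C = {}" and disjB: "B \<inter> C = {}" if C: "C \<in> star_model G v" for C
    using C
  proof (atomize (full), elim starE)
    assume "C = {Inl v}"
    then show "A \<inter> C = {} \<and> B \<inter> C = {}" using uW u(2) by (auto simp: A_def B_def)
  next
    fix s assume "C = {Inr {v, s}}"
    then show "A \<inter> C = {} \<and> B \<inter> C = {}" using uW vne by (auto simp: A_def B_def)
  qed
  have adjI: "\<exists>b\<in>X. \<exists>c\<in>C. {b, c} \<in> edges ?T" if "b \<in> X" "c \<in> C" "{b, c} \<in> edges ?T" for b c X C
    using that by blast
  have adjA: "\<exists>b\<in>A. \<exists>c\<in>C. {b, c} \<in> edges ?T" if "C \<in> star_model G v" for C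
    using that
  proof (rule starE)
    assume C: "C = {Inl v}"
    obtain y where y: "{v, y} \<in> edges G" "y \<notin> {u}"
      using ex_neighbour_notin[OF simple, of "{u}" v] deg by auto
    have "y \<in> W" using y simple_graph_edge[OF simple y(1)] unfolding W_def by blast
    then show ?thesis
      using y(1) by (intro adjI[of "Inl y" A "Inl v"])
        (auto simp: C A_def insert_commute intro: total_graph_edgeI)
  next
    fix s assume C: "C = {Inr {v, s}}" "{v, s} \<in> edges G" "s \<noteq> v" "s \<in> verts G"
    show ?thesis
    proof (cases "s = u")
      case True
      have "{Inr {u, w}, Inr {v, u}} \<in> edges ?T"
        using w(1) u(3) vne by (intro total_graph_edgeI) auto
      then show ?thesis by (intro adjI) (auto simp: C(1) A_def True)
    next
      case False
      then have "s \<in> W" using C unfolding W_def by blast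
      moreover have "{Inl s, Inr {v, s}} \<in> edges ?T" using C(2) by (intro total_graph_edgeI) auto
      ultimately show ?thesis by (intro adjI) (auto simp: C(1) A_def)
    qed
  qed
  have adjB: "\<exists>b\<in>B. \<exists>c\<in>C. {b, c} \<in> edges ?T" if "C \<in> star_model G v" for C
    using that
  proof (rule starE)
    assume C: "C = {Inl v}"
    have "{Inl u, Inl v} \<in> edges ?T" using uv by (rule total_graph_edgeI)
    then show ?thesis by (intro adjI) (auto simp: C B_def)
  next
    fix s assume C: "C = {Inr {v, s}}" "{v, s} \<in> edges G" "s \<noteq> v" "s \<in> verts G"
    show ?thesis
    proof (cases "s = u")
      case True
      have "{Inl u, Inr {v, u}} \<in> edges ?T" using u(3) by (intro total_graph_edgeI) auto
      then show ?thesis by (intro adjI) (auto simp: C(1) B_def True)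
    next
      case False
      then have "s \<in> W" using C unfolding W_def by blast
      moreover have "{s, v} \<in> edges G" using C(2) by (simp add: insert_commute)
      ultimately obtain e where e: "e \<in> edges G" "s \<in> e" "e \<subseteq> W" using in_W by blast
      have "{Inr e, Inr {v, s}} \<in> edges ?T"
        using e C(2) uW by (intro total_graph_edgeI) auto
      moreover have "Inr e \<in> B" using e by (simp add: B_def)
      ultimately show ?thesis by (intro adjI) (auto simp: C(1))
    qed
  qed
  have mB: "minor_model ?T (insert B (star_model G v))"
    using minor_model_star_model[OF v] sub(2) connB disjB adjB by (rule minor_model_insert)
  have "{Inr {u, w}, Inl u} \<in> edges ?T" using w(1) by (intro total_graph_edgeI) auto
  then have adjAB: "\<exists>b\<in>A. \<exists>c\<in>B. {b, c} \<in> edges ?T" by (intro adjI) (auto simp: A_def B_def)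
  have m: "minor_model ?T (insert A (insert B (star_model G v)))"
    using mB sub(1) connA
  proof (rule minor_model_insert)
    fix C assume "C \<in> insert B (star_model G v)"
    then consider "C = B" | "C \<in> star_model G v" by blast
    then have "A \<inter> C = {} \<and> (\<exists>b\<in>A. \<exists>c\<in>C. {b, c} \<in> edges ?T)"
      using AB adjAB disjA adjA by cases simp_all
    then show "A \<inter> C = {}" "\<exists>b\<in>A. \<exists>c\<in>C. {b, c} \<in> edges ?T" by simp_all
  qed
  have "A \<notin> insert B (star_model G v)" "B \<notin> star_model G v"
    using AB disjA[of A] disjB[of B] conn_nonempty[OF connA] conn_nonempty[OF connB] by auto
  then have "card (insert A (insert B (star_model G v))) = degree G v + 3"
    using finite_star_model[OF simple] card_star_model[OF simple] by simp
  then show ?thesis using m finite_star_model[OF simple] by (meson finite_insert)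
qed

lemma minor_of_edge_choosability:
  assumes ch: "edge_choosability G = chromatic_index G"
  shows "\<exists>\<B>. finite \<B> \<and> minor_model (total_graph G) \<B> \<and> k < card \<B>"
proof -
  have noV: "verts G \<noteq> {}"
  proof
    assume V: "verts G = {}"
    then have "edges G = {}" using simple unfolding simple_graph_def by auto
    then have "total_colorable G k" using V
      by (intro total_colorableI[of _ "\<lambda>_. 0" "\<lambda>_. 0"] total_colI) auto
    then show False using not_colorable by blast
  qed
  define D where "D = Max (degree G ` verts G)"
  have D: "\<And>x. x \<in> verts G \<Longrightarrow> degree G x \<le> D"
    unfolding D_def using finite_verts by simp
  have "D \<in> degree G ` verts G" unfolding D_def using finite_verts noV by (intro Max_in) auto
  then obtain v where v: "v \<in> verts G" "degree G v = D" by blast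
  have k3: "k < D + 3"
    using total_colorable_of_edge_choosability[OF simple D ch, of k] not_colorable by force
  \<comment> \<open>Without edges one colour suffices. For \<open>k = 0\<close> the maximum degree
    may be 0, but then the star alone is large enough.\<close>
  have D0: "0 < D" if "0 < k"
  proof (rule ccontr)
    assume "\<not> 0 < D"
    have "edges G = {}"
    proof (rule ccontr)
      assume "edges G \<noteq> {}"
      then obtain e where e: "e \<in> edges G" by blast
      obtain a b where ab: "e = {a, b}" "a \<in> verts G" using simple e by (rule simple_graph_edgeE)
      then have "0 < degree G a" unfolding degree_def using e finite_edges_at[of a] by (auto simp: card_gt_0_iff)
      then show False using D[OF ab(2)] \<open>\<not> 0 < D\<close> by simp
    qed
    then have "total_colorable G k" using that
      by (intro total_colorableI[of _ "\<lambda>_. 0" "\<lambda>_. 0"] total_colI) auto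
    then show False using not_colorable by blast
  qed
  \<comment> \<open>More than \<open>k\<close> branch sets are wanted and the star has
    \<open>D + 1\<close>: the cases lack none, one or two.\<close>
  consider "k \<le> D" | "k = D + 1" | "k = D + 2" using k3 by linarith
  then show ?thesis
  proof cases
    case 1
    then have "k < card (star_model G v)" using card_star_model[OF simple, of v] v(2) by simp
    then show ?thesis using minor_model_star_model[OF v(1)] finite_star_model[OF simple] by blast
  next
    case 2
    then have "0 < degree G v" "degree G v < k" using D0 v(2) by simp_all
    then show ?thesis using minor_plus_two[OF v(1)] v(2) 2 by auto
  next
    case 3
    have "0 < D" using D0 3 by simp
    then obtain x0 where x0: "{v, x0} \<in> edges G" using ex_neighbour_notin[OF simple, of "{}" v] v(2) by auto
    have x0V: "x0 \<in> verts G" "x0 \<noteq> v" using simple_graph_edge[OF simple x0] by auto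
    have two: "conn G (verts G - {x})" if x: "x \<in> verts G" for x
    proof (rule conn_delete_vertex[OF x])
      show "degree G x < k" using D[OF x] 3 by simp
      show "verts G \<noteq> {x}" using x0V v(1) by auto
    qed
    have "conn G (insert v (verts G - {v}))" using two[OF v(1)] _ x0 by (rule conn_insert) (use x0V in simp)
    then have conn: "conn G (verts G)" using v(1) by (simp add: insert_absorb)
    have pos: "0 < degree G x" if "{x, y} \<in> edges G" for x y
      unfolding degree_def using that finite_edges_at[of x] by (auto simp: card_gt_0_iff)
    have large: "k < degree G x + degree G y" if "{x, y} \<in> edges G" "2 * degree G x < k" for x y
      using that by (rule degree_sum)
    have le: "degree G x \<le> D" "degree G y \<le> D" if "{x, y} \<in> edges G" for x y
      using D simple_graph_edge[OF simple that] by auto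
    \<comment> \<open>For \<open>D = 1\<close> and \<open>k = 3\<close> the degree sum along the
      edge from \<open>v\<close> to \<open>x0\<close> would have to exceed 3, but it is at most
      2.\<close>
    have "D \<noteq> 1" using large[OF x0] le[OF x0] v(2) 3 by auto
    moreover have "D \<noteq> 2"
    proof
      assume "D = 2"
      then have "degree G v \<noteq> 2" using max_degree_ne_two[OF _ conn _ v(1)] D 3 by simp
      then show False using v(2) \<open>D = 2\<close> by simp
    qed
    ultimately have D3: "2 < D" using \<open>0 < D\<close> by linarith
    \<comment> \<open>If \<open>2 * degree G x < D + 2\<close>, the degree sum exceeds
      \<open>D + 2\<close>, of which \<open>y\<close> contributes at most \<open>D\<close>.
      Otherwise \<open>2 * degree G x\<close> is at least \<open>D + 2\<close>, hence at least 5 by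
      \<open>2 < D\<close>.\<close>
    have three: "2 < degree G x" if "{x, y} \<in> edges G" for x y
      using large[OF that] le[OF that] 3 D3 by linarith
    have "2 < degree G v" using v(2) D3 by simp
    then have "\<exists>\<B>. finite \<B> \<and> minor_model (total_graph G) \<B> \<and> card \<B> = degree G v + 3"
      using two three by (rule minor_plus_three[OF v(1)])
    then show ?thesis using v(2) 3 by auto
  qed
qed

end

section \<open>Passage to a critical subgraph\<close>

lemma subgraph_refl: "simple_graph G \<Longrightarrow> subgraph G G"
  by (simp add: subgraph_def)

lemma subgraph_trans: "subgraph H G \<Longrightarrow> subgraph G K \<Longrightarrow> subgraph H K"
  by (auto simp: subgraph_def)

lemma ex_total_critical_subgraph:
  assumes G: "simple_graph G" and "\<not> total_colorable G k"
  obtains H where "subgraph H G" "total_critical H k"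
proof -
  have "simple_graph G \<Longrightarrow> \<not> total_colorable G k \<Longrightarrow> \<exists>H. subgraph H G \<and> total_critical H k" for G :: "'a graph"
  proof (induction "card (verts G) + card (edges G)" arbitrary: G rule: less_induct)
    case less
    show ?case
    proof (cases "total_critical G k")
      case True
      then show ?thesis using subgraph_refl less.prems(1) by blast
    next
      case False
      then obtain H where H: "subgraph H G" "H \<noteq> G" "\<not> total_colorable H k"
        using less.prems unfolding total_critical_def by blast
      have fin: "finite (verts G)" "finite (edges G)"
        using less.prems(1) simple_graph_finite_edges by (auto simp: simple_graph_def)
      have sub: "verts H \<subseteq> verts G" "edges H \<subseteq> edges G" "simple_graph H"
        using H(1) by (simp_all add: subgraph_def)
      have "verts H \<noteq> verts G \<or> edges H \<noteq> edges G" using H(2) graph.expand by blast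
      then have "card (verts H) < card (verts G) \<or> card (edges H) < card (edges G)"
        using sub fin by (meson psubsetI psubset_card_mono)
      then have "card (verts H) + card (edges H) < card (verts G) + card (edges G)"
        using card_mono[OF fin(1) sub(1)] card_mono[OF fin(2) sub(2)] by linarith
      then show ?thesis using less.hyps[OF _ sub(3) H(3)] subgraph_trans[OF _ H(1)] by blast
    qed
  qed
  then show ?thesis using assms that by blast
qed

lemma total_graph_mono:
  assumes "subgraph H G"
  shows "verts (total_graph H) \<subseteq> verts (total_graph G)" "edges (total_graph H) \<subseteq> edges (total_graph G)"
proof -
  have sub: "verts H \<subseteq> verts G" "edges H \<subseteq> edges G" using assms by (simp_all add: subgraph_def)
  then show "verts (total_graph H) \<subseteq> verts (total_graph G)" by (auto simp: total_graph_def)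
  show "edges (total_graph H) \<subseteq> edges (total_graph G)"
  proof
    fix x assume "x \<in> edges (total_graph H)"
    then show "x \<in> edges (total_graph G)"
      by (cases rule: total_graph_edgeE) (use sub(2) in \<open>auto intro!: total_graph_edgeI\<close>)
  qed
qed

theorem theorem9:
  fixes F :: "'a graph set"
  assumes "\<And>G. G \<in> F \<Longrightarrow> simple_graph G"
    and "\<And>G H. G \<in> F \<Longrightarrow> subgraph H G \<Longrightarrow> H \<in> F"
    and "\<And>G. G \<in> F \<Longrightarrow> edge_choosability G = chromatic_index G"
  shows "\<forall>G\<in>F. \<forall>t::nat. t > 0 \<longrightarrow> chromatic_number (total_graph G) \<ge> t \<longrightarrow>
           is_minor (complete_graph t) (total_graph G)"
proof (intro ballI allI impI)
  fix G and t :: nat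
  assume G: "G \<in> F" and t: "t > 0" "chromatic_number (total_graph G) \<ge> t"
  have simple: "simple_graph G" using assms(1) G by blast
  have "\<not> total_colorable G (t - 1)"
    using chromatic_number_total_graph_le[of G "t - 1"] t by linarith
  then obtain H where H: "subgraph H G" "total_critical H (t - 1)"
    by (rule ex_total_critical_subgraph[OF simple])
  have "edge_choosability H = chromatic_index H" using assms(2,3) G H(1) by blast
  then obtain \<B> where \<B>: "minor_model (total_graph H) \<B>" "t - 1 < card \<B>"
    using total_critical.minor_of_edge_choosability[OF H(2)] by blast
  then obtain \<C> where \<C>: "\<C> \<subseteq> \<B>" "card \<C> = t"
    using obtain_subset_with_card_n[of t \<B>] t(1) by (metis Suc_leI Suc_pred' One_nat_def)
  have "minor_model (total_graph G) \<C>"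
    using minor_model_subset[OF \<B>(1) \<C>(1)] total_graph_mono[OF H(1)] by (rule minor_model_mono)
  then show "is_minor (complete_graph t) (total_graph G)"
    using minor_model_is_minor[OF simple_graph_total_graph[OF simple]] \<C>(2) by blast
qed

end
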